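(* Fix an integer $d\geq 2$. Let $f_0(z) = z^d$ and $g_0(z) = \zeta z^d$ for $\zeta = e^{2\pi i/(d+1)}$, and let $\psi = (f,g): \mathbb{D} \to \mathrm{Rat}_d\times\mathrm{Rat}_d$, $t\mapsto (f_t,g_t)$, be a holomorphic map from the unit disk $\mathbb{D}\subset \mathbb{C}$ with $\psi(0) = (f_0, g_0)$. If $$\mathrm{Preper}(f_t)\cap J(f_t) = \mathrm{Preper}(g_t) \cap J(g_t)$$ for all $t \in \mathbb{D}$, where $J$ denotes the Julia set, then this family of pairs is isotrivial.
   Context: $\mathrm{Rat}_d$ denotes the space of all holomorphic maps $\mathbb{P}^1\to\mathbb{P}^1$ of degree $d$ over $\mathbb{C}$, identified via coefficients with a Zariski-open subset of $\mathbb{P}^{2d+1}$. $\mathrm{Preper}(\cdot)$ denotes the set of preperiodic points in $\mathbb{P}^1(\mathbb{C})$. $\mathrm{Aut}\,\mathbb{P}^1\simeq\mathrm{PSL}_2\mathbb{C}$ acts on $\mathrm{Rat}_d\times\mathrm{Rat}_d$ by simultaneous conjugation $A\cdot (f,g) = (A\circ f\circ A^{-1}, A\circ g\circ A^{-1})$. The family of pairs is isotrivial if the induced map $\mathbb{D}\to(\mathrm{Rat}_d\times\mathrm{Rat}_d)/\mathrm{Aut}\,\mathbb{P}^1$ is constant. *)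

theory Defs
  imports "HOL-Complex_Analysis.Complex_Analysis" "HOL-Computational_Algebra.Computational_Algebra"
begin

datatype P1 = Fin complex | Infty

(* Inverse stereographic projection onto the unit sphere of \<complex> \<times> \<real>; the
   Euclidean distance of the images is the chordal metric. *)
fun stereo :: "P1 \<Rightarrow> complex \<times> real" where
  "stereo (Fin z) = (of_real (2 / (1 + (cmod z)\<^sup>2)) * z, ((cmod z)\<^sup>2 - 1) / (1 + (cmod z)\<^sup>2))"
| "stereo Infty = (0, 1)"

lemma inj_stereo: "inj stereo"
proof (rule injI)
  fix x y assume eq: "stereo x = stereo y"
  have snd_eq: "((cmod z)\<^sup>2 - 1) / (1 + (cmod z)\<^sup>2) = 1 - 2 / (1 + (cmod z)\<^sup>2)" for z
  proof -
    have "1 + (cmod z)\<^sup>2 \<noteq> 0" by (smt (verit) zero_le_power2)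
    then show ?thesis by (simp add: field_simps)
  qed
  have pos: "1 + (cmod z)\<^sup>2 > 0" for z
    by (smt (verit) zero_le_power2)
  have nz: "2 / (1 + (cmod z)\<^sup>2) \<noteq> 0" for z
    using pos[of z] by simp
  show "x = y"
  proof (cases x; cases y)
    fix z w assume xy: "x = Fin z" "y = Fin w"
    have c: "2 / (1 + (cmod z)\<^sup>2) = 2 / (1 + (cmod w)\<^sup>2)"
      using eq unfolding xy stereo.simps snd_eq by simp
    have "complex_of_real (2 / (1 + (cmod z)\<^sup>2)) * z = complex_of_real (2 / (1 + (cmod z)\<^sup>2)) * w"
      using eq unfolding xy stereo.simps c by simp
    then have "z = w"
      using nz[of z] by (metis mult_left_cancel of_real_eq_0_iff)
    then show "x = y" using xy by simp
  next
    fix z assume "x = Fin z" "y = Infty"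
    then show "x = y" using eq nz[of z] unfolding snd_eq stereo.simps by simp
  next
    fix w assume "x = Infty" "y = Fin w"
    then show "x = y" using eq nz[of w] unfolding snd_eq stereo.simps by simp
  qed simp
qed

instantiation P1 :: metric_space
begin

definition dist_P1 :: "P1 \<Rightarrow> P1 \<Rightarrow> real" where
  "dist_P1 x y = dist (stereo x) (stereo y)"

definition uniformity_P1 :: "(P1 \<times> P1) filter" where
  "uniformity_P1 = (INF e\<in>{0<..}. principal {(x, y). dist x y < e})"

definition open_P1 :: "P1 set \<Rightarrow> bool" where
  "open_P1 U \<longleftrightarrow> (\<forall>x\<in>U. eventually (\<lambda>(x', y). x' = x \<longrightarrow> y \<in> U) uniformity)"

instance
proof
  fix x y z :: P1
  show "dist x y = 0 \<longleftrightarrow> x = y"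
    by (simp add: dist_P1_def inj_eq[OF inj_stereo])
  show "dist x y \<le> dist x z + dist y z"
    unfolding dist_P1_def by (rule dist_triangle2)
qed (simp_all add: uniformity_P1_def open_P1_def)

end

text \<open>The point \<open>[x : y]\<close>; the value at \<open>x = y = 0\<close> is never used.\<close>

definition proj :: "complex \<Rightarrow> complex \<Rightarrow> P1" where
  "proj x y = (if y = 0 then Infty else Fin (x / y))"

text \<open>The map \<open>p / q\<close>, in homogeneous coordinates \<open>[X : Y] \<mapsto> [P(X, Y) : Q(X, Y)]\<close>, where
  \<open>P\<close> and \<open>Q\<close> are the degree \<open>d\<close> homogenisations of \<open>p\<close> and \<open>q\<close>.\<close>

fun rat_map :: "nat \<Rightarrow> complex poly \<Rightarrow> complex poly \<Rightarrow> P1 \<Rightarrow> P1" where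
  "rat_map d p q (Fin z) = proj (poly p z) (poly q z)"
| "rat_map d p q Infty = proj (coeff p d) (coeff q d)"

definition rat_pair :: "nat \<Rightarrow> complex poly \<Rightarrow> complex poly \<Rightarrow> bool" where
  "rat_pair d p q \<longleftrightarrow> coprime p q \<and> max (degree p) (degree q) = d"

definition Rat :: "nat \<Rightarrow> (P1 \<Rightarrow> P1) set" where
  "Rat d = {rat_map d p q | p q. rat_pair d p q}"

text \<open>Holomorphic maps from an open set \<open>S\<close> to \<open>Rat d \<subseteq> \<P>\<^bsup>2d+1\<^esup>\<close>: near every point of \<open>S\<close> there are
  homogeneous coordinates (the coefficients of numerator and denominator) that depend
  holomorphically on the parameter.\<close>

definition holomorphic_to_Rat :: "nat \<Rightarrow> (complex \<Rightarrow> P1 \<Rightarrow> P1) \<Rightarrow> complex set \<Rightarrow> bool" where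
  "holomorphic_to_Rat d f S \<longleftrightarrow>
     (\<forall>t0\<in>S. \<exists>U p q. open U \<and> t0 \<in> U \<and> U \<subseteq> S \<and>
        (\<forall>i\<le>d. (\<lambda>t. coeff (p t) i) holomorphic_on U \<and> (\<lambda>t. coeff (q t) i) holomorphic_on U) \<and>
        (\<forall>t\<in>U. rat_pair d (p t) (q t) \<and> f t = rat_map d (p t) (q t)))"

definition Aut_P1 :: "(P1 \<Rightarrow> P1) set" where
  "Aut_P1 = {rat_map 1 [:b, a:] [:d, c:] | a b c d. a * d - b * c \<noteq> 0}"

lemma moebius_inverse:
  assumes "a * e - b * c \<noteq> 0"
  shows "rat_map 1 [:- b, a:] [:e, - c:] (rat_map 1 [:b, e:] [:a, c:] x) = x"
proof (cases x)
  case (Fin z)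
  show ?thesis
  proof (cases "a + z * c = 0")
    case True
    then have "c \<noteq> 0" using assms by (metis add.right_neutral diff_self mult_zero_left mult_zero_right)
    have "a = - (z * c)" using True by (simp add: eq_neg_iff_add_eq_0)
    then show ?thesis using True Fin \<open>c \<noteq> 0\<close> by (simp add: proj_def)
  next
    case False
    have "e - (b + z * e) / (a + z * c) * c = (a * e - b * c) / (a + z * c)"
      using False by (simp add: field_simps)
    moreover have "- b + (b + z * e) / (a + z * c) * a = (a * e - b * c) * z / (a + z * c)"
      using False by (simp add: field_simps)
    moreover have "rat_map 1 [:- b, a:] [:e, - c:] (rat_map 1 [:b, e:] [:a, c:] x) =
        proj (- b + (b + z * e) / (a + z * c) * a) (e - (b + z * e) / (a + z * c) * c)"
      using False Fin by (simp add: proj_def)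
    ultimately show ?thesis
      using False Fin assms by (simp only: proj_def) simp
  qed
next
  case Infty
  show ?thesis
  proof (cases "c = 0")
    case True
    then show ?thesis using Infty by (simp add: proj_def)
  next
    case False
    then show ?thesis using Infty by (simp add: proj_def)
  qed
qed

lemma bij_Aut_P1: "A \<in> Aut_P1 \<Longrightarrow> bij A"
proof -
  assume "A \<in> Aut_P1"
  then obtain a b c d where A: "A = rat_map 1 [:b, a:] [:d, c:]" and nz: "a * d - b * c \<noteq> 0"
    unfolding Aut_P1_def by blast
  have "rat_map 1 [:- b, d:] [:a, - c:] (A x) = x" for x
    using moebius_inverse[of d a b c x] nz unfolding A by (simp add: mult.commute)
  moreover have "A (rat_map 1 [:- b, d:] [:a, - c:] x) = x" for x
    using moebius_inverse[of a d "- b" "- c" x] nz unfolding A by simp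
  ultimately show "bij A"
    by (metis bijI')
qed

text \<open>The point of \<open>(Rat d \<times> Rat d) / Aut_P1\<close> represented by a pair of maps;
  \<open>inv A\<close> is the inverse map by \<open>bij_Aut_P1\<close>.\<close>

definition conj_orbit :: "(P1 \<Rightarrow> P1) \<times> (P1 \<Rightarrow> P1) \<Rightarrow> ((P1 \<Rightarrow> P1) \<times> (P1 \<Rightarrow> P1)) set" where
  "conj_orbit = (\<lambda>(f, g). {(A \<circ> f \<circ> inv A, A \<circ> g \<circ> inv A) | A. A \<in> Aut_P1})"

definition isotrivial_on :: "complex set \<Rightarrow> (complex \<Rightarrow> (P1 \<Rightarrow> P1) \<times> (P1 \<Rightarrow> P1)) \<Rightarrow> bool" where
  "isotrivial_on S \<psi> \<longleftrightarrow> (\<lambda>t. conj_orbit (\<psi> t)) constant_on S"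

definition Preper :: "('a \<Rightarrow> 'a) \<Rightarrow> 'a set" where
  "Preper f = {x. \<exists>m n. m < n \<and> (f ^^ m) x = (f ^^ n) x}"

definition normal_family_on :: "P1 set \<Rightarrow> (P1 \<Rightarrow> P1) set \<Rightarrow> bool" where
  "normal_family_on U F \<longleftrightarrow>
     (\<forall>h :: nat \<Rightarrow> P1 \<Rightarrow> P1. range h \<subseteq> F \<longrightarrow>
        (\<exists>r l. strict_mono (r :: nat \<Rightarrow> nat) \<and>
           (\<forall>K. compact K \<and> K \<subseteq> U \<longrightarrow> uniform_limit K (h \<circ> r) l sequentially)))"

definition Fatou :: "(P1 \<Rightarrow> P1) \<Rightarrow> P1 set" where
  "Fatou f = {x. \<exists>U. open U \<and> x \<in> U \<and> normal_family_on U (range (\<lambda>n. f ^^ n))}"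

definition Julia :: "(P1 \<Rightarrow> P1) \<Rightarrow> P1 set" where
  "Julia f = - Fatou f"

end

theory Submission
  imports Defs "HOL-Computational_Algebra.Field_as_Ring"
begin

text \<open>
  Near \<open>t = 0\<close> both maps expand a neighbourhood of the unit circle, and there the hypothesis is
  turned into an identity between the two dynamical systems. Let \<open>X\<close> be the set of roots of unity
  of order \<open>2 * d * (d + 1)\<close>; it is finite and mapped into itself by \<open>z\<^sup>d\<close> and by \<open>\<zeta> z\<^sup>d\<close>.
  Expansion lets every \<open>a \<in> X\<close> be followed holomorphically to a point \<open>x a t\<close> with
  \<open>f t (x a t) = x (a ^ d) t\<close> (\<open>holomorphic_shadowing\<close>), and puts this preperiodic point into
  the Julia set of \<open>f t\<close> (\<open>expanding_orbit_in_Julia\<close>). By hypothesis it is then preperiodic for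
  \<open>g t\<close>. There are only countably many possible preperiods and periods but uncountably many
  parameters, so one pair of them works for all \<open>t\<close> (\<open>uniform_preperiod\<close>). Since \<open>g t\<close> expands as
  well, a preperiodic orbit is determined by the finite orbit that it stays close to, whence
  \<open>g t (x a t) = x (\<zeta> * a ^ d) t\<close> (\<open>local_orbit_portrait\<close>).

  The rest is algebra at one parameter. The fibre of \<open>f t\<close> over \<open>x (\<zeta> ^ k) t\<close> is also the fibre of
  \<open>g t\<close> over \<open>x (\<zeta> ^ (k + 1)) t\<close>, so \<open>g = \<sigma> \<circ> f\<close> with a Moebius map \<open>\<sigma>\<close>. At the centre the relation
  \<open>g \<circ> g = f \<circ> f\<close> holds, because \<open>\<zeta> ^ (d + 1) = 1\<close>; it persists on the portrait, which has more
  points than the degree \<open>2 d\<^sup>2\<close> of the polynomial identity in question, hence everywhere.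
  Finally \<open>\<sigma>\<close> rotates the cycle \<open>x (\<zeta> ^ k) t\<close>, so the ratio of its eigenvalues is a root of unity of
  order \<open>d + 1\<close>, and by continuity it is \<open>\<zeta>\<close>. A pair with these three properties is called
  a \<open>twisted_pair\<close> below.

  A twisted pair is conjugate to \<open>(z\<^sup>d, \<zeta> z\<^sup>d)\<close> (\<open>twisted_pair_conj_power\<close>): in a coordinate in which
  \<open>\<sigma>\<close> is \<open>z \<mapsto> \<zeta> z\<close>, the equation \<open>\<sigma> f \<sigma> f = f f\<close> becomes \<open>\<zeta> f(\<zeta> z) = f(z)\<close>, and among the rational
  maps of degree \<open>d \<ge> 2\<close> only the multiples of \<open>z\<^sup>d\<close> satisfy it, as a comparison of coefficients
  shows; here it matters that \<open>\<zeta>\<close> is a primitive root of unity.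

  Being twisted amounts to holomorphic equations in the coefficients of numerators and
  denominators (\<open>twist_equations_iff\<close>). They hold near \<open>0\<close>, hence on the whole disk by the identity
  theorem, and all pairs lie in the orbit of \<open>(z\<^sup>d, \<zeta> z\<^sup>d)\<close>.
\<close>

section \<open>Rational maps in homogeneous coordinates\<close>

definition hom_eval :: "nat \<Rightarrow> complex poly \<Rightarrow> complex \<Rightarrow> complex \<Rightarrow> complex" where
  "hom_eval d p X Y = (\<Sum>i\<le>d. coeff p i * X ^ i * Y ^ (d - i))"

lemma hom_eval_affine: "degree p \<le> d \<Longrightarrow> hom_eval d p z 1 = poly p z"
  unfolding hom_eval_def poly_altdef
  by (rule sum.mono_neutral_cong_right) (auto simp: coeff_eq_0)

lemma hom_eval_infty: "hom_eval d p X 0 = coeff p d * X ^ d"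
proof -
  have "hom_eval d p X 0 = (\<Sum>i\<in>{d}. coeff p i * X ^ i * 0 ^ (d - i))"
    unfolding hom_eval_def by (rule sum.mono_neutral_right) auto
  then show ?thesis by simp
qed

lemma hom_eval_scale: "hom_eval d p (k * X) (k * Y) = k ^ d * hom_eval d p X Y"
  unfolding hom_eval_def sum_distrib_left
  by (rule sum.cong) (auto simp: power_mult_distrib power_add[symmetric] algebra_simps
    simp flip: power_add)

lemma hom_eval_dehom:
  assumes "degree p \<le> d" "Y \<noteq> 0"
  shows "hom_eval d p X Y = Y ^ d * poly p (X / Y)"
  using hom_eval_scale[of d p Y "X / Y" 1] hom_eval_affine[OF assms(1)] assms(2) by simp

lemma hom_eval_linear:
  "hom_eval d (smult a p + smult b q) X Y = a * hom_eval d p X Y + b * hom_eval d q X Y"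
  unfolding hom_eval_def sum_distrib_left sum.distrib[symmetric]
  by (rule sum.cong) (auto simp: algebra_simps)

lemma proj_scale: "k \<noteq> 0 \<Longrightarrow> proj (k * X) (k * Y) = proj X Y"
  by (simp add: proj_def)

lemma proj_eq_iff:
  assumes "X \<noteq> 0 \<or> Y \<noteq> 0" "X' \<noteq> 0 \<or> Y' \<noteq> 0"
  shows "proj X Y = proj X' Y' \<longleftrightarrow> X * Y' = X' * Y"
  using assms by (auto simp: proj_def field_simps)

lemma proj_cases:
  obtains X Y where "X \<noteq> 0 \<or> Y \<noteq> 0" "x = proj X Y"
proof (cases x)
  case (Fin z)
  then show ?thesis using that[of z 1] by (simp add: proj_def)
next
  case Infty
  then show ?thesis using that[of 1 0] by (simp add: proj_def)
qed

lemma Fin_eq_proj: "Fin z = proj z 1"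
  by (simp add: proj_def)

text \<open>The homogeneous form of a rational map treats the point at infinity like any other. Together
  with \<open>proj_cases\<close> it reduces identities between maps of the sphere to identities between forms.\<close>

lemma rat_map_proj:
  assumes "degree p \<le> d" "degree q \<le> d" "X \<noteq> 0 \<or> Y \<noteq> 0"
  shows "rat_map d p q (proj X Y) = proj (hom_eval d p X Y) (hom_eval d q X Y)"
proof (cases "Y = 0")
  case True
  then show ?thesis using assms proj_scale[of "X ^ d" "coeff p d" "coeff q d"]
    by (simp add: proj_def hom_eval_infty mult.commute)
next
  case False
  then show ?thesis using assms proj_scale[of "Y ^ d" "poly p (X / Y)" "poly q (X / Y)"]
    by (simp add: hom_eval_dehom) (simp add: proj_def)
qed

lemma rat_pair_degrees:
  "rat_pair d p q \<Longrightarrow> degree p \<le> d" "rat_pair d p q \<Longrightarrow> degree q \<le> d"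
  by (auto simp: rat_pair_def)

lemma coprime_imp_no_common_root:
  fixes p q :: "complex poly"
  assumes "coprime p q" shows "poly p z \<noteq> 0 \<or> poly q z \<noteq> 0"
proof (rule ccontr)
  assume "\<not> ?thesis"
  then have "[:- z, 1:] dvd p" "[:- z, 1:] dvd q" by (auto simp: poly_eq_0_iff_dvd)
  then have "is_unit [:- z, 1:]" using assms coprime_common_divisor by blast
  then show False by (simp add: is_unit_iff_degree)
qed

lemma rat_pair_nonzero:
  assumes "rat_pair d p q" "X \<noteq> 0 \<or> Y \<noteq> 0"
  shows "hom_eval d p X Y \<noteq> 0 \<or> hom_eval d q X Y \<noteq> 0"
proof (cases "Y = 0")
  case True
  have "coeff p d \<noteq> 0 \<or> coeff q d \<noteq> 0"
  proof (rule ccontr)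
    assume a: "\<not> ?thesis"
    have m: "max (degree p) (degree q) = d" "coprime p q" using assms by (auto simp: rat_pair_def)
    from a m(1) have "p = 0 \<or> q = 0" by (auto simp: max_def split: if_splits)
    then have "p = 0 \<and> q = 0"
    proof
      assume "p = 0"
      then have "degree q = d" using m(1) by simp
      then show ?thesis using a \<open>p = 0\<close> leading_coeff_0_iff[of q] by metis
    next
      assume "q = 0"
      then have "degree p = d" using m(1) by simp
      then show ?thesis using a \<open>q = 0\<close> leading_coeff_0_iff[of p] by metis
    qed
    then show False using m(2) by simp
  qed
  then show ?thesis using True assms by (auto simp: hom_eval_infty)
next
  case False
  have "coprime p q" using assms by (simp add: rat_pair_def)
  from coprime_imp_no_common_root[OF this, of "X / Y"] show ?thesis
    using False rat_pair_degrees[OF assms(1)] by (auto simp: hom_eval_dehom)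
qed

lemma coprime_if_no_common_root:
  fixes p q :: "complex poly"
  assumes "\<And>z. poly p z \<noteq> 0 \<or> poly q z \<noteq> 0" shows "coprime p q"
proof (rule coprimeI)
  fix r assume r: "r dvd p" "r dvd q"
  have "poly r z \<noteq> 0" for z using assms[of z] r by (auto elim!: dvdE)
  then have "degree r = 0"
    using fundamental_theorem_of_algebra_alt[of r] by (metis degree_pCons_0)
  moreover have "r \<noteq> 0" using \<open>\<And>z. poly r z \<noteq> 0\<close> by auto
  ultimately show "is_unit r" by (simp add: is_unit_iff_degree)
qed

text \<open>The converse of \<open>rat_pair_nonzero\<close>. Having no common zero as forms in two variables excludes
  both a common root and a drop of the degree, which is how compositions with Moebius maps are
  seen to have degree \<open>d\<close> again.\<close>

lemma rat_pairI:
  assumes "degree p \<le> d" "degree q \<le> d"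
    and nz: "\<And>X Y. X \<noteq> 0 \<or> Y \<noteq> 0 \<Longrightarrow> hom_eval d p X Y \<noteq> 0 \<or> hom_eval d q X Y \<noteq> 0"
  shows "rat_pair d p q"
proof -
  have "poly p z \<noteq> 0 \<or> poly q z \<noteq> 0" for z
    using nz[of z 1] assms by (simp add: hom_eval_affine)
  moreover have "coeff p d \<noteq> 0 \<or> coeff q d \<noteq> 0" using nz[of 1 0] by (simp add: hom_eval_infty)
  then have "degree p \<ge> d \<or> degree q \<ge> d" by (auto intro: le_degree)
  ultimately show ?thesis using assms coprime_if_no_common_root by (auto simp: rat_pair_def max_def)
qed

text \<open>Coprimality makes \<open>p'\<close> and \<open>q'\<close> multiples of \<open>p\<close> and \<open>q\<close> by one common polynomial; the
  degree bound leaves room only for a constant. With \<open>p'\<close> and \<open>q'\<close> constant this also yields the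
  linear independence of \<open>p\<close> and \<open>q\<close>.\<close>

lemma cross_coprime_imp_scalar:
  fixes p q p' q' :: "complex poly"
  assumes "coprime p q" "p * q' = p' * q"
    and "max (degree p') (degree q') \<le> max (degree p) (degree q)"
  shows "\<exists>c. p' = smult c p \<and> q' = smult c q"
proof -
  have "p dvd p' * q" using assms(2) by (metis dvd_triv_left)
  then have "p dvd p'" using assms(1) by (simp add: coprime_dvd_mult_left_iff)
  then obtain k where k: "p' = p * k" by blast
  have "q dvd p * q'" using assms(2) by (metis dvd_triv_right)
  then have "q dvd q'" using assms(1) by (simp add: coprime_dvd_mult_right_iff coprime_commute)
  then obtain l where l: "q' = q * l" by blast
  obtain m where m: "p' = p * m" "q' = q * m"
  proof (cases "p = 0 \<or> q = 0")
    case True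
    then show ?thesis using that k l assms(1) by auto
  next
    case False
    have "p * q * l = p * q * k" using assms(2) k l by (simp add: algebra_simps)
    then have "l = k" using False by simp
    then show ?thesis using that k l by blast
  qed
  have "degree m = 0"
  proof (cases "m = 0")
    case False
    have "degree p' = degree p + degree m" if "p \<noteq> 0" using m False that by (simp add: degree_mult_eq)
    moreover have "degree q' = degree q + degree m" if "q \<noteq> 0" using m False that by (simp add: degree_mult_eq)
    moreover have "p \<noteq> 0 \<or> q \<noteq> 0" using assms(1) by auto
    ultimately show ?thesis using assms(3)
      by (cases "p = 0"; cases "q = 0") (auto simp: max_def split: if_splits)
  qed simp
  then obtain c where "m = [:c:]" by (metis degree_eq_zeroE)
  then show ?thesis using m by auto
qed

lemma rat_map_unique:
  assumes "rat_pair d p q" "rat_pair d p' q'"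
    and "infinite {z. rat_map d p q (Fin z) = rat_map d p' q' (Fin z)}"
  shows "\<exists>c. c \<noteq> 0 \<and> p' = smult c p \<and> q' = smult c q"
proof -
  have cp: "coprime p q" "coprime p' q'" using assms by (auto simp: rat_pair_def)
  have "{z. rat_map d p q (Fin z) = rat_map d p' q' (Fin z)} \<subseteq> {z. poly (p * q' - p' * q) z = 0}"
    using proj_eq_iff coprime_imp_no_common_root[OF cp(1)] coprime_imp_no_common_root[OF cp(2)]
    by (fastforce simp: proj_eq_iff)
  then have "p * q' - p' * q = 0"
    using assms(3) poly_roots_finite finite_subset by blast
  then obtain c where c: "p' = smult c p" "q' = smult c q"
    using cross_coprime_imp_scalar[OF cp(1), of q' p'] assms(1,2) unfolding rat_pair_def by auto
  moreover have "c \<noteq> 0" using cp(2) c by auto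
  ultimately show ?thesis by blast
qed

section \<open>Moebius maps\<close>

definition mob :: "complex \<Rightarrow> complex \<Rightarrow> complex \<Rightarrow> complex \<Rightarrow> P1 \<Rightarrow> P1" where
  "mob a b c e = rat_map 1 [:b, a:] [:e, c:]"

lemma mob_proj:
  assumes "X \<noteq> 0 \<or> Y \<noteq> 0"
  shows "mob a b c e (proj X Y) = proj (a * X + b * Y) (c * X + e * Y)"
proof -
  have "hom_eval 1 [:b, a:] X Y = a * X + b * Y" for a b by (simp add: hom_eval_def)
  then show ?thesis using rat_map_proj[of "[:b,a:]" 1 "[:e,c:]" X Y] assms unfolding mob_def by simp
qed

lemma mob_nonzero:
  assumes "a * e - b * c \<noteq> 0" "X \<noteq> 0 \<or> Y \<noteq> (0::complex)"
  shows "a * X + b * Y \<noteq> 0 \<or> c * X + e * Y \<noteq> 0"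
proof (rule ccontr)
  assume "\<not> ?thesis"
  then have h: "a * X + b * Y = 0" "c * X + e * Y = 0" by auto
  have "(a * e - b * c) * X = e * (a * X + b * Y) - b * (c * X + e * Y)"
    "(a * e - b * c) * Y = a * (c * X + e * Y) - c * (a * X + b * Y)" by (auto simp: algebra_simps)
  then show False using h assms by simp
qed

lemma mob_rat_map:
  assumes "rat_pair d p q" "a * e - b * c \<noteq> 0"
  shows "mob a b c e \<circ> rat_map d p q = rat_map d (smult a p + smult b q) (smult c p + smult e q)"
    (is "_ = rat_map d ?P ?Q")
    and "rat_pair d (smult a p + smult b q) (smult c p + smult e q)"
proof -
  have deg: "degree ?P \<le> d" "degree ?Q \<le> d" "degree p \<le> d" "degree q \<le> d"
    using rat_pair_degrees[OF assms(1)] by (auto intro!: degree_add_le intro: order.trans[OF degree_smult_le])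
  show "mob a b c e \<circ> rat_map d p q = rat_map d ?P ?Q"
  proof
    fix x obtain X Y where X: "X \<noteq> 0 \<or> Y \<noteq> 0" "x = proj X Y" by (rule proj_cases)
    show "(mob a b c e \<circ> rat_map d p q) x = rat_map d ?P ?Q x"
      using rat_pair_nonzero[OF assms(1) X(1)] X deg by (simp add: rat_map_proj mob_proj hom_eval_linear)
  qed
  show "rat_pair d ?P ?Q"
  proof (rule rat_pairI[OF deg(1,2)])
    fix X Y :: complex assume "X \<noteq> 0 \<or> Y \<noteq> 0"
    then show "hom_eval d ?P X Y \<noteq> 0 \<or> hom_eval d ?Q X Y \<noteq> 0"
      unfolding hom_eval_linear by (intro mob_nonzero assms rat_pair_nonzero)
  qed
qed

lemma Aut_P1_iff: "A \<in> Aut_P1 \<longleftrightarrow> (\<exists>a b c e. a * e - b * c \<noteq> 0 \<and> A = mob a b c e)"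
  by (auto simp: Aut_P1_def mob_def)

lemma Aut_P1_comp:
  assumes "A \<in> Aut_P1" "B \<in> Aut_P1" shows "A \<circ> B \<in> Aut_P1"
proof -
  obtain a b c e where A: "a * e - b * c \<noteq> 0" "A = mob a b c e" using assms by (auto simp: Aut_P1_iff)
  obtain a' b' c' e' where B: "a' * e' - b' * c' \<noteq> 0" "B = mob a' b' c' e'"
    using assms by (auto simp: Aut_P1_iff)
  have "A \<circ> B = mob (a * a' + b * c') (a * b' + b * e') (c * a' + e * c') (c * b' + e * e')"
  proof
    fix x obtain X Y where X: "X \<noteq> 0 \<or> Y \<noteq> 0" "x = proj X Y" by (rule proj_cases)
    show "(A \<circ> B) x = mob (a * a' + b * c') (a * b' + b * e') (c * a' + e * c') (c * b' + e * e') x"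
      using mob_nonzero[OF B(1) X(1)] X A B by (simp add: mob_proj algebra_simps)
  qed
  moreover have "(a * a' + b * c') * (c * b' + e * e') - (a * b' + b * e') * (c * a' + e * c')
      = (a * e - b * c) * (a' * e' - b' * c')" by (simp add: algebra_simps)
  ultimately show ?thesis using A(1) B(1) unfolding Aut_P1_iff by (metis mult_eq_0_iff)
qed

lemma inv_mob:
  assumes "a * e - b * c \<noteq> 0"
  shows "inv (mob a b c e) = mob e (- b) (- c) a"
proof -
  have "mob e (- b) (- c) a (mob a b c e x) = x" for x
    using moebius_inverse[of e a b c x] assms by (simp add: mob_def mult.commute)
  moreover have "mob a b c e (mob e (- b) (- c) a x) = x" for x
    using moebius_inverse[of a e "- b" "- c" x] assms by (simp add: mob_def)
  ultimately show ?thesis by (intro inv_equality)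
qed

lemma Aut_P1_inv: "A \<in> Aut_P1 \<Longrightarrow> inv A \<in> Aut_P1"
proof -
  assume "A \<in> Aut_P1"
  then obtain a b c e where A: "a * e - b * c \<noteq> 0" "A = mob a b c e" by (auto simp: Aut_P1_iff)
  then have "inv A = mob e (- b) (- c) a" "e * a - (- b) * (- c) \<noteq> 0"
    using inv_mob by (auto simp: mult.commute)
  then show ?thesis unfolding Aut_P1_iff by blast
qed

text \<open>Holds because the Moebius maps form a group under composition.\<close>

lemma conj_orbit_conj:
  assumes "B \<in> Aut_P1"
  shows "conj_orbit (B \<circ> f \<circ> inv B, B \<circ> g \<circ> inv B) = conj_orbit (f, g)"
proof -
  have *: "conj_orbit (B \<circ> f \<circ> inv B, B \<circ> g \<circ> inv B) \<subseteq> conj_orbit (f, g)" if B: "B \<in> Aut_P1" for B f g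
  proof
    fix w assume "w \<in> conj_orbit (B \<circ> f \<circ> inv B, B \<circ> g \<circ> inv B)"
    then obtain A where A: "A \<in> Aut_P1"
      "w = (A \<circ> (B \<circ> f \<circ> inv B) \<circ> inv A, A \<circ> (B \<circ> g \<circ> inv B) \<circ> inv A)"
      by (auto simp: conj_orbit_def)
    have "inv (A \<circ> B) = inv B \<circ> inv A"
      using bij_Aut_P1[OF A(1)] bij_Aut_P1[OF B] by (rule o_inv_distrib)
    then have "w = ((A \<circ> B) \<circ> f \<circ> inv (A \<circ> B), (A \<circ> B) \<circ> g \<circ> inv (A \<circ> B))"
      using A(2) by (simp add: comp_assoc)
    then show "w \<in> conj_orbit (f, g)"
      using Aut_P1_comp[OF A(1) B] by (auto simp: conj_orbit_def)
  qed
  have b: "bij B" using assms by (rule bij_Aut_P1)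
  have "inv B \<circ> (B \<circ> f \<circ> inv B) \<circ> inv (inv B) = f" for f
    using b by (simp add: inv_inv_eq fun_eq_iff bij_is_inj)
  then have "conj_orbit (f, g) \<subseteq> conj_orbit (B \<circ> f \<circ> inv B, B \<circ> g \<circ> inv B)"
    using *[OF Aut_P1_inv[OF assms], of "B \<circ> f \<circ> inv B" "B \<circ> g \<circ> inv B"] by simp
  with *[OF assms] show ?thesis by blast
qed

text \<open>The polynomial obtained by substituting \<open>r\<close> and \<open>s\<close> for the two variables of the form
  \<open>hom_eval d p\<close>. It describes iterates as well as precomposition with a Moebius map.\<close>

definition hom_comp :: "nat \<Rightarrow> complex poly \<Rightarrow> complex poly \<Rightarrow> complex poly \<Rightarrow> complex poly" where
  "hom_comp d p r s = (\<Sum>i\<le>d. smult (coeff p i) (r ^ i * s ^ (d - i)))"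

lemma poly_hom_comp: "poly (hom_comp d p r s) z = hom_eval d p (poly r z) (poly s z)"
  by (simp add: hom_comp_def hom_eval_def poly_sum algebra_simps)

lemma degree_hom_comp:
  assumes "degree r \<le> n" "degree s \<le> n" shows "degree (hom_comp d p r s) \<le> d * n"
  unfolding hom_comp_def
proof (rule degree_sum_le)
  fix i assume "i \<in> {..d}"
  then have i: "i \<le> d" by simp
  have "degree (r ^ i * s ^ (d - i)) \<le> degree r * i + degree s * (d - i)"
    by (intro order.trans[OF degree_mult_le] add_mono degree_power_le)
  also have "\<dots> \<le> n * i + n * (d - i)" using assms by (intro add_mono mult_right_mono) auto
  also have "\<dots> = d * n" using i by (simp add: algebra_simps flip: distrib_left)
  finally show "degree (smult (coeff p i) (r ^ i * s ^ (d - i))) \<le> d * n"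
    using degree_smult_le order.trans by blast
qed simp

text \<open>Both sides are polynomials in \<open>Y\<close> that agree for \<open>Y \<noteq> 0\<close> by homogeneity; continuity gives
  \<open>Y = 0\<close>.\<close>

lemma hom_eval_precomp:
  "hom_eval d (hom_comp d p [:b, a:] [:e, c:]) X Y = hom_eval d p (a * X + b * Y) (c * X + e * Y)"
proof -
  let ?p = "hom_comp d p [:b, a:] [:e, c:]"
  have deg: "degree ?p \<le> d" using degree_hom_comp[of "[:b,a:]" 1 "[:e,c:]" d p] by simp
  have nz: "hom_eval d ?p X Y = hom_eval d p (a * X + b * Y) (c * X + e * Y)" if "Y \<noteq> 0" for Y
  proof -
    have "a * X + b * Y = Y * (a * (X / Y) + b)" "c * X + e * Y = Y * (c * (X / Y) + e)"
      using that by (auto simp: algebra_simps)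
    then show ?thesis using hom_eval_dehom[OF deg that, of X]
      by (simp only: hom_eval_scale poly_hom_comp) (simp add: algebra_simps)
  qed
  have cont: "continuous (at 0) (\<lambda>Y. hom_eval d ?p X Y - hom_eval d p (a * X + b * Y) (c * X + e * Y))"
    unfolding hom_eval_def by (intro continuous_intros)
  have "((\<lambda>Y. hom_eval d ?p X Y - hom_eval d p (a * X + b * Y) (c * X + e * Y)) \<longlongrightarrow> 0) (at 0)"
    by (rule tendsto_eventually) (auto simp: eventually_at_filter nz)
  with cont have "hom_eval d ?p X 0 - hom_eval d p (a * X + b * 0) (c * X + e * 0) = 0"
    unfolding continuous_at by (rule LIM_unique[OF _ ])
  then show ?thesis using nz by (cases "Y = 0") auto
qed

lemma rat_map_mob:
  assumes "rat_pair d p q" "a * e - b * c \<noteq> 0"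
  defines "p' \<equiv> hom_comp d p [:b, a:] [:e, c:]" and "q' \<equiv> hom_comp d q [:b, a:] [:e, c:]"
  shows "rat_map d p q \<circ> mob a b c e = rat_map d p' q'" and "rat_pair d p' q'"
proof -
  have deg: "degree p' \<le> d" "degree q' \<le> d"
    using degree_hom_comp[of "[:b,a:]" 1 "[:e,c:]" d] by (simp_all add: p'_def q'_def)
  show "rat_map d p q \<circ> mob a b c e = rat_map d p' q'"
  proof
    fix x obtain X Y where X: "X \<noteq> 0 \<or> Y \<noteq> 0" "x = proj X Y" by (rule proj_cases)
    show "(rat_map d p q \<circ> mob a b c e) x = rat_map d p' q' x"
      using mob_nonzero[OF assms(2) X(1)] X deg rat_pair_degrees[OF assms(1)]
      by (simp add: rat_map_proj mob_proj) (simp add: p'_def q'_def hom_eval_precomp)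
  qed
  show "rat_pair d p' q'"
    by (rule rat_pairI[OF deg], simp only: p'_def q'_def hom_eval_precomp)
      (intro rat_pair_nonzero mob_nonzero assms)
qed

section \<open>Twisted pairs are conjugate to the power maps\<close>

lemma right_eigenvector:
  fixes a b c e l :: complex
  assumes "l * l - (a + e) * l + (a * e - b * c) = 0"
  shows "\<exists>x y. (x \<noteq> 0 \<or> y \<noteq> 0) \<and> a * x + b * y = l * x \<and> c * x + e * y = l * y"
proof (cases "b \<noteq> 0 \<or> l \<noteq> a")
  case True
  have "c * b + e * (l - a) = l * (l - a) - (l * l - (a + e) * l + (a * e - b * c))"
    by (simp add: algebra_simps)
  then show ?thesis using True assms
    by (intro exI[of _ b] exI[of _ "l - a"]) (auto simp: algebra_simps)
next
  case False
  then have *: "b = 0" "l = a" by auto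
  show ?thesis
  proof (cases "c \<noteq> 0 \<or> l \<noteq> e")
    case True
    then show ?thesis using * by (intro exI[of _ "l - e"] exI[of _ c]) (auto simp: algebra_simps)
  next
    case False
    then show ?thesis using * by (intro exI[of _ 1] exI[of _ 0]) auto
  qed
qed

text \<open>The equation between trace and determinant says that the eigenvalues are \<open>\<zeta> * l\<close> and \<open>l\<close>
  for \<open>l = (a + e) / (1 + \<zeta>)\<close>. In the basis of eigenvectors the Moebius map is \<open>z \<mapsto> \<zeta> z\<close>.\<close>

lemma eigenbasis_of_trace_det:
  fixes a b c e \<zeta> :: complex
  assumes tr: "\<zeta> * (a + e)\<^sup>2 = (1 + \<zeta>)\<^sup>2 * (a * e - b * c)" and det: "a * e - b * c \<noteq> 0"
    and z: "\<zeta> \<noteq> 1" "1 + \<zeta> \<noteq> 0"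
  obtains x1 y1 x2 y2 l where "l \<noteq> 0" "x1 * y2 - x2 * y1 \<noteq> 0"
    "a * x1 + b * y1 = \<zeta> * l * x1" "c * x1 + e * y1 = \<zeta> * l * y1"
    "a * x2 + b * y2 = l * x2" "c * x2 + e * y2 = l * y2"
proof -
  define l where "l = (a + e) / (1 + \<zeta>)"
  have tr': "a + e = l * (1 + \<zeta>)" using z by (simp add: l_def)
  have "(1 + \<zeta>)\<^sup>2 * (\<zeta> * l\<^sup>2) = (1 + \<zeta>)\<^sup>2 * (a * e - b * c)"
    using tr unfolding tr' by (simp only: power_mult_distrib mult_ac)
  then have det': "a * e - b * c = \<zeta> * (l * l)" using z by (simp add: power2_eq_square)
  have l: "l \<noteq> 0" "\<zeta> \<noteq> 0" using det unfolding det' by auto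
  have "l * l - (a + e) * l + (a * e - b * c) = 0" unfolding tr' det' by (simp add: algebra_simps)
  from right_eigenvector[OF this] obtain x2 y2
    where v2: "x2 \<noteq> 0 \<or> y2 \<noteq> 0" "a * x2 + b * y2 = l * x2" "c * x2 + e * y2 = l * y2" by blast
  have "(\<zeta> * l) * (\<zeta> * l) - (a + e) * (\<zeta> * l) + (a * e - b * c) = 0"
    unfolding tr' det' by (simp add: algebra_simps)
  from right_eigenvector[OF this] obtain x1 y1
    where v1: "x1 \<noteq> 0 \<or> y1 \<noteq> 0" "a * x1 + b * y1 = \<zeta> * l * x1" "c * x1 + e * y1 = \<zeta> * l * y1" by blast
  have "x1 * y2 - x2 * y1 \<noteq> 0"
  proof
    assume "x1 * y2 - x2 * y1 = 0"
    then have eq: "x1 * y2 = x2 * y1" by simp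
    have "\<zeta> * l * x1 * x2 = a * x1 * x2 + b * (x2 * y1)" unfolding v1(2)[symmetric] by (simp add: algebra_simps)
    also have "\<dots> = x1 * (l * x2)" unfolding eq[symmetric] v2(2)[symmetric] by (simp add: algebra_simps)
    finally have x: "x1 * x2 = 0" using l z by simp
    have "\<zeta> * l * y1 * y2 = c * (x1 * y2) + e * y1 * y2" unfolding v1(3)[symmetric] by (simp add: algebra_simps)
    also have "\<dots> = y1 * (l * y2)" unfolding eq v2(3)[symmetric] by (simp add: algebra_simps)
    finally have "y1 * y2 = 0" using l z by simp
    with x eq v1(1) v2(1) show False by auto
  qed
  then show ?thesis using that l v1 v2 by blast
qed

text \<open>Comparing coefficients in \<open>\<zeta> F(\<zeta> z) = F(z)\<close>, \<open>F = p / q\<close>, gives \<open>\<zeta> ^ Suc i = c\<close> whenever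
  \<open>p\<close> has a term of degree \<open>i\<close>, and \<open>\<zeta> ^ j = c\<close> whenever \<open>q\<close> has a term of degree \<open>j\<close>. As the
  exponents lie between \<open>0\<close> and \<open>d\<close>, either \<open>j = i + 1\<close>, or \<open>i = d\<close> and \<open>j = 0\<close>. Degree \<open>d \<ge> 2\<close>
  and the absence of a common root at \<open>0\<close> leave only the second possibility.\<close>

lemma monomial_if_twisted_equivariant:
  assumes rp: "rat_pair d p q" and d: "d \<ge> 2"
    and \<zeta>: "\<And>i j. \<zeta> ^ i = \<zeta> ^ j \<longleftrightarrow> i mod (d + 1) = j mod (d + 1)"
    and inf: "infinite {w. rat_map d p q (Fin w) = mob \<zeta> 0 0 1 (rat_map d p q (mob \<zeta> 0 0 1 (Fin w)))}"
  obtains k m where "k \<noteq> 0" "m \<noteq> 0" "p = monom k d" "q = [:m:]"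
proof -
  have z0: "\<zeta> \<noteq> 0" using \<zeta>[of 0 1] \<zeta>[of 1 2] d by auto
  then have det: "\<zeta> * 1 - 0 * 0 \<noteq> 0" by simp
  define p1 q1 where "p1 = hom_comp d p [:0, \<zeta>:] [:1, 0:]" and "q1 = hom_comp d q [:0, \<zeta>:] [:1, 0:]"
  have r1: "rat_map d p q \<circ> mob \<zeta> 0 0 1 = rat_map d p1 q1" "rat_pair d p1 q1"
    unfolding p1_def q1_def using rat_map_mob[OF rp det] by auto
  have r2: "mob \<zeta> 0 0 1 \<circ> rat_map d p1 q1 = rat_map d (smult \<zeta> p1 + smult 0 q1) (smult 0 p1 + smult 1 q1)"
    "rat_pair d (smult \<zeta> p1 + smult 0 q1) (smult 0 p1 + smult 1 q1)"
    using mob_rat_map[OF r1(2) det] by auto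
  have "infinite {w. rat_map d p q (Fin w) = rat_map d (smult \<zeta> p1 + smult 0 q1) (smult 0 p1 + smult 1 q1) (Fin w)}"
    using inf unfolding r2(1)[symmetric] r1(1)[symmetric] by simp
  from rat_map_unique[OF rp r2(2) this] obtain c
    where c: "smult \<zeta> p1 = smult c p" "q1 = smult c q" by auto
  have c1: "coeff (hom_comp d r [:0, \<zeta>:] [:1, 0:]) i = \<zeta> ^ i * coeff r i" if "degree r \<le> d" for r i
  proof -
    have "[:0, \<zeta>:] ^ j * [:1, 0:] ^ m = monom (\<zeta> ^ j) j" for j m
      by (simp add: monom_0 monom_Suc monom_power flip: monom_altdef one_pCons)
        (metis monom_0 monom_Suc monom_power mult_1 power_Suc0_right One_nat_def)
    then have "coeff (hom_comp d r [:0, \<zeta>:] [:1, 0:]) i = (\<Sum>j\<le>d. if j = i then coeff r j * \<zeta> ^ j else 0)"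
      unfolding hom_comp_def by (simp add: coeff_sum if_distrib cong: if_cong)
    then show ?thesis using that by (auto simp: coeff_eq_0)
  qed
  have cp: "\<zeta> ^ Suc i * coeff p i = c * coeff p i" for i
    using arg_cong[OF c(1), of "\<lambda>r. coeff r i"] c1[OF rat_pair_degrees(1)[OF rp]] by (simp add: p1_def)
  have cq: "\<zeta> ^ i * coeff q i = c * coeff q i" for i
    using arg_cong[OF c(2), of "\<lambda>r. coeff r i"] c1[OF rat_pair_degrees(2)[OF rp]] by (simp add: q1_def)
  have deg: "degree p \<le> d" "degree q \<le> d" using rat_pair_degrees rp by auto
  have ij: "(j = Suc i \<and> i < d) \<or> (i = d \<and> j = 0)" if "coeff p i \<noteq> 0" "coeff q j \<noteq> 0" for i j
  proof -
    have "i \<le> d" "j \<le> d" using that deg by (meson le_degree order.trans)+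
    moreover have "\<zeta> ^ Suc i = \<zeta> ^ j" using cp[of i] cq[of j] that by simp
    then have "Suc i mod (d + 1) = j mod (d + 1)" using \<zeta> by blast
    ultimately show ?thesis by (cases "i = d") auto
  qed
  have cop: "coprime p q" and mx: "max (degree p) (degree q) = d" using rp by (auto simp: rat_pair_def)
  have unit: "degree r = 0" if "is_unit r" for r :: "complex poly"
    using that is_unit_iff_degree by (metis not_is_unit_0)
  have "p \<noteq> 0" "q \<noteq> 0"
    using cop mx d unit[of p] unit[of q] by auto
  then have lc: "coeff p (degree p) \<noteq> 0" "coeff q (degree q) \<noteq> 0" by auto
  have "degree p = d"
  proof (rule ccontr)
    assume "degree p \<noteq> d"
    then have "degree q = d" using mx by (auto simp: max_def split: if_splits)
    have "coeff p 0 = 0" using ij[of 0 d] lc(2) \<open>degree q = d\<close> d by auto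
    moreover have "coeff q 0 = 0" using ij[of "degree p" 0] lc(1) \<open>degree p \<noteq> d\<close> by auto
    ultimately show False using coprime_imp_no_common_root[OF cop, of 0] by (simp add: poly_0_coeff_0)
  qed
  have "degree q = 0" using ij[OF lc] \<open>degree p = d\<close> by auto
  then obtain m where m: "q = [:m:]" by (metis degree_eq_zeroE)
  with \<open>q \<noteq> 0\<close> have m0: "m \<noteq> 0" by auto
  have "coeff p i = 0" if "i \<noteq> d" for i
    using ij[of i 0] that m m0 by auto
  then have "p = monom (coeff p d) d" by (intro poly_eqI) auto
  moreover have "coeff p d \<noteq> 0" using lc \<open>degree p = d\<close> by auto
  ultimately show ?thesis using that m m0 by blast
qed

text \<open>Otherwise some fibre would be infinite, and \<open>p\<close> and \<open>q\<close> would be proportional.\<close>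

lemma infinite_image_rat_map:
  assumes "rat_pair d p q" "d \<ge> 1"
  shows "infinite ((rat_map d p q \<circ> Fin) ` UNIV)"
proof
  assume "finite ((rat_map d p q \<circ> Fin) ` UNIV)"
  from pigeonhole_infinite[OF infinite_UNIV_char_0 this] obtain z0
    where inf: "infinite {z. rat_map d p q (Fin z) = rat_map d p q (Fin z0)}" by auto
  have cop: "coprime p q" using assms by (auto simp: rat_pair_def)
  note nz = coprime_imp_no_common_root[OF cop]
  let ?P = "poly p z0" and ?Q = "poly q z0"
  have "{z. rat_map d p q (Fin z) = rat_map d p q (Fin z0)} \<subseteq> {z. poly (p * [:?Q:] - [:?P:] * q) z = 0}"
    using proj_eq_iff[OF nz nz] by (auto simp: mult.commute)
  then have "p * [:?Q:] - [:?P:] * q = 0"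
    using inf poly_roots_finite finite_subset by blast
  then have "p * [:?Q:] = [:?P:] * q" by simp
  moreover have "max (degree [:?P:]) (degree [:?Q:]) \<le> max (degree p) (degree q)" by simp
  ultimately obtain c where c: "[:?P:] = smult c p" "[:?Q:] = smult c q"
    using cross_coprime_imp_scalar[OF cop] by blast
  then have "c \<noteq> 0" using nz[of z0] by auto
  then have "degree p = 0" "degree q = 0" using c by (metis degree_pCons_0 degree_smult_eq)+
  then show False using assms by (auto simp: rat_pair_def)
qed

text \<open>The Moebius map \<open>\<sigma> = mob a b c e\<close> has eigenvalues of ratio \<open>\<zeta>\<close>. This is expressed by trace and
  determinant because these depend holomorphically on the parameter, unlike the eigenvalues.\<close>

definition twisted_pair :: "complex \<Rightarrow> (P1 \<Rightarrow> P1) \<Rightarrow> (P1 \<Rightarrow> P1) \<Rightarrow> bool" where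
  "twisted_pair \<zeta> f g \<longleftrightarrow>
     (\<exists>a b c e. a * e - b * c \<noteq> 0 \<and> \<zeta> * (a + e)\<^sup>2 = (1 + \<zeta>)\<^sup>2 * (a * e - b * c) \<and> g = mob a b c e \<circ> f) \<and>
     (\<forall>z. f (f (Fin z)) = g (g (Fin z)))"

lemma mob_comp_inv:
  assumes "A \<in> Aut_P1"
  shows "A (inv A x) = x" "inv A (A x) = x"
  using bij_Aut_P1[OF assms] by (simp_all add: bij_is_surj bij_is_inj surj_f_inv_f)

text \<open>Let \<open>T\<close> diagonalise \<open>\<sigma>\<close>, so that \<open>\<sigma> T = T R\<close> with the rotation \<open>R z = \<zeta> z\<close>, and put
  \<open>F = T\<inverse> f T\<close>. On the image of \<open>f\<close> the relation \<open>f f = \<sigma> f \<sigma> f\<close> can be cancelled to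
  \<open>f = \<sigma> f \<sigma>\<close>, that is \<open>F = R F R\<close>. Hence \<open>F\<close> is a multiple of the power map, and a scaling \<open>B\<close>
  removes the factor.\<close>

lemma twisted_pair_conj_power:
  assumes rp: "rat_pair d p q" and f: "f = rat_map d p q" and d: "d \<ge> 2"
    and tw: "twisted_pair \<zeta> f g"
    and \<zeta>: "\<And>i j. \<zeta> ^ i = \<zeta> ^ j \<longleftrightarrow> i mod (d + 1) = j mod (d + 1)"
  obtains A where "A \<in> Aut_P1" "f = A \<circ> rat_map d (monom 1 d) 1 \<circ> inv A"
    "g = A \<circ> rat_map d (monom \<zeta> d) 1 \<circ> inv A"
proof -
  have z: "\<zeta> \<noteq> 1" "\<zeta> \<noteq> 0" using \<zeta>[of 0 1] \<zeta>[of 1 2] d by auto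
  have "\<zeta>\<^sup>2 \<noteq> 1" using \<zeta>[of 0 2] d by auto
  then have z1: "1 + \<zeta> \<noteq> 0" by (metis add_eq_0_iff power2_minus one_power2)
  obtain a b c e where det: "a * e - b * c \<noteq> 0"
    and tr: "\<zeta> * (a + e)\<^sup>2 = (1 + \<zeta>)\<^sup>2 * (a * e - b * c)" and g: "g = mob a b c e \<circ> f"
    and ff: "\<And>z. f (f (Fin z)) = g (g (Fin z))" using tw unfolding twisted_pair_def by blast
  obtain x1 y1 x2 y2 l where l: "l \<noteq> 0" and V: "x1 * y2 - x2 * y1 \<noteq> 0"
    and ev: "a * x1 + b * y1 = \<zeta> * l * x1" "c * x1 + e * y1 = \<zeta> * l * y1"
    "a * x2 + b * y2 = l * x2" "c * x2 + e * y2 = l * y2"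
    by (rule eigenbasis_of_trace_det[OF tr det z(1) z1])
  define T S R where "T = mob x1 x2 y1 y2" and "S = mob a b c e" and "R = mob \<zeta> 0 0 1"
  have T: "T \<in> Aut_P1" using V unfolding T_def Aut_P1_iff by blast
  have iT: "inv T = mob y2 (- x2) (- y1) x1" unfolding T_def by (rule inv_mob[OF V])
  have ST: "S (T x) = T (R x)" for x
  proof -
    obtain X Y where X: "X \<noteq> 0 \<or> Y \<noteq> 0" "x = proj X Y" by (rule proj_cases)
    have h1: "a * (x1 * X + x2 * Y) + b * (y1 * X + y2 * Y) = l * (x1 * (\<zeta> * X) + x2 * Y)"
    proof -
      have "a * (x1 * X + x2 * Y) + b * (y1 * X + y2 * Y) = (a * x1 + b * y1) * X + (a * x2 + b * y2) * Y"
        by (simp add: algebra_simps)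
      then show ?thesis unfolding ev by (simp add: algebra_simps)
    qed
    have h2: "c * (x1 * X + x2 * Y) + e * (y1 * X + y2 * Y) = l * (y1 * (\<zeta> * X) + y2 * Y)"
    proof -
      have "c * (x1 * X + x2 * Y) + e * (y1 * X + y2 * Y) = (c * x1 + e * y1) * X + (c * x2 + e * y2) * Y"
        by (simp add: algebra_simps)
      then show ?thesis unfolding ev by (simp add: algebra_simps)
    qed
    have "S (T x) = proj (a * (x1 * X + x2 * Y) + b * (y1 * X + y2 * Y)) (c * (x1 * X + x2 * Y) + e * (y1 * X + y2 * Y))"
      using X mob_nonzero[OF V X(1)] by (simp add: S_def T_def mob_proj)
    also have "\<dots> = proj (x1 * (\<zeta> * X) + x2 * Y) (y1 * (\<zeta> * X) + y2 * Y)"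
      unfolding h1 h2 using l by (rule proj_scale)
    also have "\<dots> = T (R x)" using X z by (simp add: T_def R_def mob_proj)
    finally show ?thesis .
  qed
  have iTS: "inv T (S x) = R (inv T x)" for x
    using ST[of "inv T x"] mob_comp_inv[OF T] by metis
  define p1 q1 where "p1 = hom_comp d p [:x2, x1:] [:y2, y1:]" and "q1 = hom_comp d q [:x2, x1:] [:y2, y1:]"
  have r1: "f \<circ> T = rat_map d p1 q1" "rat_pair d p1 q1"
    unfolding p1_def q1_def f T_def using rat_map_mob[OF rp V] by auto
  define p2 q2 where "p2 = smult y2 p1 + smult (- x2) q1" and "q2 = smult (- y1) p1 + smult x1 q1"
  have "y2 * x1 - (- x2) * (- y1) \<noteq> 0" using V by (simp add: mult.commute)
  from mob_rat_map[OF r1(2) this]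
  have r2: "inv T \<circ> (f \<circ> T) = rat_map d p2 q2" "rat_pair d p2 q2"
    unfolding iT r1(1) p2_def q2_def by auto
  define F where "F = rat_map d p2 q2"
  have F: "F x = inv T (f (T x))" for x unfolding F_def r2(1)[symmetric] by simp
  have key: "F x = R (F (R x))" if "x \<in> inv T ` (f \<circ> Fin) ` UNIV" for x
  proof -
    obtain z where x: "x = inv T (f (Fin z))" using \<open>x \<in> _\<close> by auto
    have "f (T x) = S (f (S (T x)))" using ff[of z] unfolding x mob_comp_inv[OF T] g S_def by simp
    then show ?thesis unfolding F using iTS ST by metis
  qed
  have "infinite (inv T ` (f \<circ> Fin) ` UNIV)"
    using infinite_image_rat_map[OF rp] d finite_imageD[of "inv T"]
      bij_is_inj[OF bij_Aut_P1[OF Aut_P1_inv[OF T]]] unfolding f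
    by (metis (no_types, lifting) inj_on_subset one_le_numeral order.trans subset_UNIV)
  then have "infinite (inv T ` (f \<circ> Fin) ` UNIV - {Infty})" by simp
  moreover have "inv T ` (f \<circ> Fin) ` UNIV - {Infty} \<subseteq> Fin ` {w. F (Fin w) = R (F (R (Fin w)))}"
  proof
    fix x assume x: "x \<in> inv T ` (f \<circ> Fin) ` UNIV - {Infty}"
    then obtain w where "x = Fin w" by (cases x) auto
    then show "x \<in> Fin ` {w. F (Fin w) = R (F (R (Fin w)))}" using key[of x] x by blast
  qed
  ultimately have "infinite {w. F (Fin w) = R (F (R (Fin w)))}"
    using finite_subset by blast
  then obtain k m where km: "k \<noteq> 0" "m \<noteq> 0" "p2 = monom k d" "q2 = [:m:]"
    using monomial_if_twisted_equivariant[OF r2(2) d \<zeta>] unfolding F_def R_def by blast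
  \<comment> \<open>Conjugation by \<open>z \<mapsto> s z\<close> turns \<open>z\<^sup>d\<close> into \<open>s\<^sup>1\<^sup>-\<^sup>d z\<^sup>d\<close>.\<close>
  have "card {s. s ^ (d - 1) = m / k} = d - 1" using km d by (intro card_nth_roots) auto
  then have "{s. s ^ (d - 1) = m / k} \<noteq> {}" using d by (intro notI) simp
  then obtain s where s: "s ^ (d - 1) = m / k" by blast
  have s0: "s \<noteq> 0" using s km d by (auto simp: power_0_left)
  have "s ^ d = s * s ^ (d - 1)" using d by (metis One_nat_def Suc_diff_le diff_Suc_Suc diff_zero numeral_2_eq_2
    power_Suc Suc_le_D)
  then have sd: "k * s ^ d = m * s" using km s by simp
  define B where "B = mob s 0 0 1"
  have B: "B \<in> Aut_P1" using s0 unfolding B_def Aut_P1_iff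
    by (metis diff_zero mult.right_neutral mult_zero_left)
  have hm: "hom_eval d (monom u d) X Y = u * X ^ d" for u X Y
    by (simp add: hom_eval_def if_distrib[of "\<lambda>x. x * _"] cong: if_cong)
  have h1: "hom_eval d [:u:] X Y = u * Y ^ d" for u X Y
  proof -
    have "hom_eval d [:u:] X Y = (\<Sum>i\<le>d. if i = 0 then u * Y ^ d else 0)"
      unfolding hom_eval_def by (rule sum.cong) (auto simp: coeff_pCons split: nat.splits)
    then show ?thesis by simp
  qed
  have dm: "degree (monom u d) \<le> d" for u :: complex by (rule degree_monom_le)
  let ?f0 = "rat_map d (monom 1 d) 1" and ?g0 = "rat_map d (monom \<zeta> d) 1"
  have fB: "F (B x) = B (?f0 x)" and RB: "R (B (?f0 x)) = B (?g0 x)" for x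
  proof -
    obtain X Y where X: "X \<noteq> 0 \<or> Y \<noteq> 0" "x = proj X Y" by (rule proj_cases)
    have X': "s * X \<noteq> 0 \<or> Y \<noteq> 0" "X ^ d \<noteq> 0 \<or> Y ^ d \<noteq> 0" using X s0 by auto
    have f0: "rat_map d (monom u d) 1 x = proj (u * X ^ d) (Y ^ d)" for u
      using X rat_map_proj[OF dm[of u], of 1 X Y] h1[of 1] by (simp add: hm one_pCons)
    have "F (B x) = proj (k * (s * X) ^ d) (m * Y ^ d)"
      using X X' rat_map_proj[OF dm[of k], of "[:m:]" "s * X" Y]
      by (simp add: F_def km B_def mob_proj hm h1)
    also have "k * (s * X) ^ d = m * (s * X ^ d)"
      using arg_cong[OF sd, of "\<lambda>u. u * X ^ d"] by (simp add: power_mult_distrib mult_ac)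
    also have "proj (m * (s * X ^ d)) (m * Y ^ d) = proj (s * X ^ d) (Y ^ d)" using km by (intro proj_scale) auto
    also have "\<dots> = B (?f0 x)" using X' by (simp add: f0 B_def mob_proj)
    finally show "F (B x) = B (?f0 x)" .
    have "R (B (?f0 x)) = proj (\<zeta> * (s * X ^ d)) (Y ^ d)"
      using X' s0 unfolding f0 B_def R_def by (subst mob_proj; simp)+
    also have "\<dots> = B (?g0 x)"
      using X' z unfolding f0 B_def by (subst mob_proj) (auto simp: algebra_simps)
    finally show "R (B (?f0 x)) = B (?g0 x)" .
  qed
  define A where "A = T \<circ> B"
  have A: "A \<in> Aut_P1" unfolding A_def using T B by (rule Aut_P1_comp)
  have fA: "f (A x) = A (?f0 x)" for x
    using F[of "B x"] fB[of x] mob_comp_inv[OF T] unfolding A_def comp_def by metis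
  have "g (A x) = A (?g0 x)" for x
    using fA[of x] ST RB unfolding g S_def[symmetric] A_def comp_def by metis
  with fA have "f = A \<circ> ?f0 \<circ> inv A" "g = A \<circ> ?g0 \<circ> inv A"
    by (auto simp: fun_eq_iff) (metis mob_comp_inv[OF A])+
  with A show ?thesis by (rule that)
qed

section \<open>Finite orbit portraits force twistedness\<close>

lemma rat_pair_independent:
  assumes rp: "rat_pair d p q" and d: "d \<ge> 1" and eq: "smult \<alpha> p = smult \<beta> q"
  shows "\<alpha> = 0" "\<beta> = 0"
proof -
  have cop: "coprime p q" using rp by (simp add: rat_pair_def)
  have "p * [:\<alpha>:] = [:\<beta>:] * q" using eq by simp
  then obtain c where c: "[:\<beta>:] = smult c p" "[:\<alpha>:] = smult c q"
    using cross_coprime_imp_scalar[OF cop, of "[:\<alpha>:]" "[:\<beta>:]"] by auto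
  have "c = 0"
  proof (rule ccontr)
    assume "c \<noteq> 0"
    then have "degree p = 0" "degree q = 0" using c by (metis degree_pCons_0 degree_smult_eq)+
    then show False using rp d by (auto simp: rat_pair_def)
  qed
  then show "\<alpha> = 0" "\<beta> = 0" using c by auto
qed

text \<open>The roots force \<open>h\<close> to have degree exactly \<open>d\<close>. Subtracting a multiple of it from \<open>H\<close> then
  leaves a polynomial of lower degree with at least \<open>d\<close> roots.\<close>

lemma proportional_of_common_roots:
  fixes h H :: "complex poly"
  assumes "degree h \<le> d" "degree H \<le> d" "card Z \<ge> d" "h \<noteq> 0"
    and "\<And>z. z \<in> Z \<Longrightarrow> poly h z = 0 \<and> poly H z = 0"
  obtains k where "H = smult k h"
proof -
  have "coeff h d \<noteq> 0"
  proof
    assume "coeff h d = 0"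
    then have "h = 0" using assms by (intro poly_eqI_degree_lead_coeff[of h d 0 Z]) auto
    then show False using assms(4) by simp
  qed
  then have "H = smult (coeff H d / coeff h d) h"
    using assms order.trans[OF degree_smult_le assms(1)]
    by (intro poly_eqI_degree_lead_coeff[of H d _ Z]) auto
  then show ?thesis by (rule that)
qed

lemma left_eigenvector:
  fixes a b c e l :: complex
  assumes "l * l - (a + e) * l + (a * e - b * c) = 0"
  shows "\<exists>x y. (x \<noteq> 0 \<or> y \<noteq> 0) \<and> x * a + y * c = l * x \<and> x * b + y * e = l * y"
  using right_eigenvector[of l a e c b] assms by (simp add: mult.commute)

text \<open>The vectors \<open>(x k, 1)\<close> lift a cycle of the Moebius map \<open>mob a b c e\<close>, and their pairing with a
  left eigenvector is multiplied by the eigenvalue at each step, up to the factors \<open>c * x k + e\<close>.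
  The number \<open>\<rho>\<close> is the ratio of the two eigenvalues.\<close>

lemma eigenvalue_ratio_of_cycle:
  fixes a b c e :: complex and x :: "nat \<Rightarrow> complex"
  assumes det: "a * e - b * c \<noteq> 0"
    and cyc: "\<And>k. a * x k + b = x (Suc k) * (c * x k + e)" "\<And>k. c * x k + e \<noteq> 0"
    and n: "x n = x 0" "x 1 \<noteq> x 0"
  obtains \<rho> where "\<rho> ^ n = 1" "\<rho> * (a + e)\<^sup>2 = (1 + \<rho>)\<^sup>2 * (a * e - b * c)"
proof -
  define D where "D = csqrt ((a + e)\<^sup>2 - 4 * (a * e - b * c))"
  define l1 l2 where "l1 = ((a + e) + D) / 2" and "l2 = ((a + e) - D) / 2"
  have D: "D * D = (a + e)\<^sup>2 - 4 * (a * e - b * c)" using power2_csqrt by (simp add: D_def power2_eq_square[symmetric])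
  have tr: "l1 + l2 = a + e" by (simp add: l1_def l2_def field_simps)
  have "l1 * l2 = ((a + e)\<^sup>2 - D * D) / 4" by (simp add: l1_def l2_def field_simps power2_eq_square)
  then have dt: "l1 * l2 = a * e - b * c" by (simp add: D)
  have l0: "l1 \<noteq> 0" "l2 \<noteq> 0" using det dt by auto
  \<comment> \<open>The \<open>n\<close> steps back to \<open>x 0\<close> multiply \<open>u * x 0 + v\<close> by \<open>m\<close>, whatever the left
    eigenvector \<open>(u, v)\<close>: both eigenvalues therefore have the same \<open>n\<close>-th power.\<close>
  define m where "m = (\<Prod>k<n. c * x k + e)"
  have pow: "l ^ n = m" if l: "l * l - (a + e) * l + (a * e - b * c) = 0" for l
  proof -
    obtain u v where uv: "u \<noteq> 0 \<or> v \<noteq> 0" "u * a + v * c = l * u" "u * b + v * e = l * v"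
      using left_eigenvector[OF l] by blast
    have step: "l * (u * x k + v) = (c * x k + e) * (u * x (Suc k) + v)" for k
    proof -
      have "l * (u * x k + v) = (u * a + v * c) * x k + (u * b + v * e)" unfolding uv by (simp add: algebra_simps)
      also have "\<dots> = u * (a * x k + b) + v * (c * x k + e)" by (simp add: algebra_simps)
      finally show ?thesis unfolding cyc(1) by (simp add: algebra_simps)
    qed
    have "l ^ j * (u * x 0 + v) = (\<Prod>k<j. c * x k + e) * (u * x j + v)" for j
    proof (induction j)
      case (Suc j)
      have "l ^ Suc j * (u * x 0 + v) = (\<Prod>k<j. c * x k + e) * (l * (u * x j + v))"
        using Suc by (simp add: mult_ac)
      then show ?case unfolding step by (simp add: mult_ac)
    qed simp
    from this[of n] have "l ^ n * (u * x 0 + v) = m * (u * x 0 + v)" by (simp add: m_def n)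
    moreover have "u * x 0 + v \<noteq> 0"
    proof
      assume 0: "u * x 0 + v = 0"
      then have "u * x 1 + v = 0" using step[of 0] cyc(2)[of 0] by simp
      moreover have "u * (x 1 - x 0) = (u * x 1 + v) - (u * x 0 + v)" by (simp add: algebra_simps)
      ultimately have "u * (x 1 - x 0) = 0" using 0 by simp
      then have "u = 0" using n(2) by simp
      with 0 uv(1) show False by simp
    qed
    ultimately show ?thesis by simp
  qed
  have "l1 * l1 - (a + e) * l1 + (a * e - b * c) = 0" "l2 * l2 - (a + e) * l2 + (a * e - b * c) = 0"
    unfolding tr[symmetric] dt[symmetric] by (simp_all add: algebra_simps)
  then have "l1 ^ n = l2 ^ n" using pow by metis
  then have "(l1 / l2) ^ n = 1" using l0 by (simp add: power_divide)
  moreover have "l1 / l2 * (a + e)\<^sup>2 = (1 + l1 / l2)\<^sup>2 * (a * e - b * c)"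
    unfolding tr[symmetric] dt[symmetric] using l0 by (simp add: field_simps power2_eq_square)
  ultimately show ?thesis by (rule that)
qed

lemma rat_map_twice:
  assumes rp: "rat_pair d p q"
  shows "rat_map d p q (rat_map d p q (Fin z)) = proj (poly (hom_comp d p p q) z) (poly (hom_comp d q p q) z)"
    and "poly (hom_comp d p p q) z \<noteq> 0 \<or> poly (hom_comp d q p q) z \<noteq> 0"
proof -
  have nz: "poly p z \<noteq> 0 \<or> poly q z \<noteq> 0"
    using rp by (intro coprime_imp_no_common_root) (simp add: rat_pair_def)
  show "rat_map d p q (rat_map d p q (Fin z)) = proj (poly (hom_comp d p p q) z) (poly (hom_comp d q p q) z)"
    using rat_map_proj[OF rat_pair_degrees[OF rp] nz] by (simp add: poly_hom_comp)
  show "poly (hom_comp d p p q) z \<noteq> 0 \<or> poly (hom_comp d q p q) z \<noteq> 0"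
    unfolding poly_hom_comp by (rule rat_pair_nonzero[OF rp nz])
qed

text \<open>The cross product of the homogeneous coordinates of \<open>f \<circ> f\<close> and \<open>g \<circ> g\<close>, for \<open>f = p / q\<close> and
  \<open>g = P / Q\<close>.\<close>

definition square_defect :: "nat \<Rightarrow> complex poly \<Rightarrow> complex poly \<Rightarrow> complex poly \<Rightarrow> complex poly \<Rightarrow> complex poly" where
  "square_defect d p q P Q = hom_comp d p p q * hom_comp d Q P Q - hom_comp d P P Q * hom_comp d q p q"

lemma square_defect_iff:
  assumes "rat_pair d p q" "rat_pair d P Q"
  shows "rat_map d p q (rat_map d p q (Fin z)) = rat_map d P Q (rat_map d P Q (Fin z)) \<longleftrightarrow>
    poly (square_defect d p q P Q) z = 0"
  unfolding rat_map_twice(1)[OF assms(1)] rat_map_twice(1)[OF assms(2)]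
    proj_eq_iff[OF rat_map_twice(2)[OF assms(1)] rat_map_twice(2)[OF assms(2)]]
  by (simp add: square_defect_def)

text \<open>The polynomials \<open>p - x(\<zeta>\<^sup>k) q\<close> and \<open>P - x(\<zeta>\<^sup>k\<^sup>+\<^sup>1) Q\<close> vanish on the same \<open>d\<close> points of the
  portrait, hence they are proportional. Two values of \<open>k\<close> suffice to express \<open>P\<close> and \<open>Q\<close> by \<open>p\<close>
  and \<open>q\<close>. The order \<open>2 * d * (d + 1)\<close> of the roots of unity is chosen such that \<open>X\<close> contains the
  \<open>d\<close>-th roots of every \<open>\<zeta>\<^sup>k\<close> and has more than \<open>2 d\<^sup>2\<close> elements.\<close>

lemma twisted_of_portrait:
  fixes d :: nat and \<zeta> :: complex and x :: "complex \<Rightarrow> complex"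
  assumes d: "d \<ge> 2" and rp: "rat_pair d p q" and rP: "rat_pair d P Q"
    and \<zeta>: "\<zeta> ^ (d + 1) = 1" "\<zeta> \<noteq> 1"
  defines "X \<equiv> {z. z ^ (2 * d * (d + 1)) = 1}"
  assumes inj: "inj_on x X"
    and fx: "\<And>a. a \<in> X \<Longrightarrow> rat_map d p q (Fin (x a)) = Fin (x (a ^ d))"
    and gx: "\<And>a. a \<in> X \<Longrightarrow> rat_map d P Q (Fin (x a)) = Fin (x (\<zeta> * a ^ d))"
  obtains a b c e \<rho> where "P = smult a p + smult b q" "Q = smult c p + smult e q"
    "\<rho> ^ (d + 1) = 1" "\<rho> * (a + e)\<^sup>2 = (1 + \<rho>)\<^sup>2 * (a * e - b * c)"
    "square_defect d p q P Q = 0"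
proof -
  let ?N = "2 * d * (d + 1)"
  have z0: "\<zeta> \<noteq> 0" using \<zeta> by (auto simp: power_0_left)
  have \<zeta>N: "\<zeta> ^ (2 * (d + 1)) = 1" "\<zeta> ^ ?N = 1"
  proof -
    show "\<zeta> ^ (2 * (d + 1)) = 1" using \<zeta>(1) by (metis mult.commute power_mult power_one)
    have "\<zeta> ^ ?N = (\<zeta> ^ (d + 1)) ^ (2 * d)" by (simp only: power_mult[symmetric] mult.commute)
    then show "\<zeta> ^ ?N = 1" using \<zeta>(1) by simp
  qed
  have XI: "j \<in> X" if "j ^ d = \<zeta> ^ k" for j k
  proof -
    have "j ^ ?N = (j ^ d) ^ (2 * (d + 1))" by (simp only: power_mult[symmetric] mult_ac)
    also have "\<dots> = (\<zeta> ^ (2 * (d + 1))) ^ k" unfolding that by (simp only: power_mult[symmetric] mult.commute)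
    finally show ?thesis using \<zeta>N by (simp add: X_def)
  qed
  have Xd: "a ^ d \<in> X" if "a \<in> X" for a
  proof -
    have "(a ^ d) ^ ?N = (a ^ ?N) ^ d" by (simp only: power_mult[symmetric] mult.commute)
    then show ?thesis using that by (simp add: X_def)
  qed
  have X\<zeta>: "\<zeta> * a \<in> X" if "a \<in> X" for a
    using that \<zeta>N(2) by (simp add: X_def power_mult_distrib)
  have XZ: "\<zeta> ^ k \<in> X" for k
    by (induction k) (auto simp: X\<zeta>, simp add: X_def)
  have FinD: "poly r z = w * poly s z \<and> poly s z \<noteq> 0" if "rat_map d r s (Fin z) = Fin w" for r s z w
    using that by (auto simp: proj_def split: if_splits)
  define y where "y k = x (\<zeta> ^ k)" for k
  define Z where "Z k = x ` {j. j ^ d = \<zeta> ^ k}" for k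
  have cardZ: "card (Z k) = d" for k
  proof -
    have "inj_on x {j. j ^ d = \<zeta> ^ k}" using XI by (intro inj_on_subset[OF inj]) auto
    then show ?thesis unfolding Z_def using z0 d by (simp add: card_image card_nth_roots)
  qed
  have fib: "poly p z = y k * poly q z \<and> poly q z \<noteq> 0 \<and> poly P z = y (Suc k) * poly Q z \<and> poly Q z \<noteq> 0"
    if "z \<in> Z k" for z k
  proof -
    obtain j where j: "j ^ d = \<zeta> ^ k" "z = x j" using \<open>z \<in> Z k\<close> unfolding Z_def by auto
    from FinD[OF fx[OF XI[OF j(1)]]] FinD[OF gx[OF XI[OF j(1)]]] show ?thesis
      unfolding j y_def by simp
  qed
  have y01: "y (Suc k) \<noteq> y k" for k
  proof
    assume "y (Suc k) = y k"
    then have "\<zeta> ^ Suc k = \<zeta> ^ k" using inj_onD[OF inj] XZ unfolding y_def by blast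
    then show False using z0 \<zeta>(2) by simp
  qed
  have fibre_ratio: "\<exists>m. P - smult (y (Suc k)) Q = smult m (p - smult (y k) q)" for k
  proof (rule proportional_of_common_roots[of "p - smult (y k) q" d "P - smult (y (Suc k)) Q" "Z k"])
    show "degree (p - smult (y k) q) \<le> d" "degree (P - smult (y (Suc k)) Q) \<le> d"
      using rat_pair_degrees[OF rp] rat_pair_degrees[OF rP]
      by (auto intro!: degree_diff_le intro: order.trans[OF degree_smult_le])
    show "card (Z k) \<ge> d" using cardZ by simp
    show "p - smult (y k) q \<noteq> 0"
      using rat_pair_independent(1)[OF rp, of 1 "y k"] d by auto
    show "poly (p - smult (y k) q) z = 0 \<and> poly (P - smult (y (Suc k)) Q) z = 0" if "z \<in> Z k" for z
      using fib[OF that] by simp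
  qed blast
  \<comment> \<open>Eliminating \<open>P\<close> from the relations for \<open>k = 0\<close> and \<open>k = 1\<close> expresses \<open>Q\<close>, and then \<open>P\<close>.\<close>
  obtain m0 m1 where m: "P - smult (y 1) Q = smult m0 (p - smult (y 0) q)"
    "P - smult (y 2) Q = smult m1 (p - smult (y 1) q)"
    using fibre_ratio[of 0] fibre_ratio[of 1] by (auto simp: numeral_2_eq_2)
  define w where "w = y 2 - y 1"
  have w: "w \<noteq> 0" using y01[of 1] by (simp add: w_def numeral_2_eq_2)
  have "smult w Q = (P - smult (y 1) Q) - (P - smult (y 2) Q)" by (simp add: w_def smult_diff_left)
  also have "\<dots> = smult (m0 - m1) p + smult (m1 * y 1 - m0 * y 0) q"
    unfolding m by (simp add: smult_diff_left smult_diff_right)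
  finally have wQ: "smult (inverse w) (smult w Q) = smult (inverse w) (smult (m0 - m1) p + smult (m1 * y 1 - m0 * y 0) q)"
    by simp
  define c e where "c = inverse w * (m0 - m1)" and "e = inverse w * (m1 * y 1 - m0 * y 0)"
  have Q: "Q = smult c p + smult e q" using wQ w by (simp add: c_def e_def smult_add_right)
  define a b where "a = y 1 * c + m0" and "b = y 1 * e - m0 * y 0"
  have "P = smult (y 1) Q + smult m0 (p - smult (y 0) q)" using m(1) by (simp add: algebra_simps)
  then have P: "P = smult a p + smult b q"
    unfolding Q a_def b_def by (simp add: smult_add_right smult_add_left smult_diff_right smult_diff_left)
  have det: "a * e - b * c \<noteq> 0"
  proof
    assume 0: "a * e - b * c = 0"
    have "smult e P = smult b Q" "smult c P = smult a Q"
      unfolding P Q using 0 by (simp_all add: smult_add_right mult_ac)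
    then have "a = 0" "b = 0" using rat_pair_independent[OF rP] d by auto
    then have "smult 1 P = smult 0 Q" using P by simp
    then show False using rat_pair_independent(1)[OF rP, of 1 0] d by simp
  qed
  have cyc: "a * y k + b = y (Suc k) * (c * y k + e) \<and> c * y k + e \<noteq> 0" for k
  proof -
    have "Z k \<noteq> {}" using cardZ[of k] d by auto
    then obtain z where "z \<in> Z k" by blast
    note f = fib[OF this]
    have "(a * y k + b) * poly q z = poly P z" unfolding P using f by (simp add: algebra_simps)
    moreover have eq: "(c * y k + e) * poly q z = poly Q z" unfolding Q using f by (simp add: algebra_simps)
    ultimately have "(a * y k + b) * poly q z = (y (Suc k) * (c * y k + e)) * poly q z" using f by simp
    moreover have "c * y k + e \<noteq> 0" using eq f by auto
    ultimately show ?thesis using f by simp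
  qed
  have "y (d + 1) = y 0" "y 1 \<noteq> y 0" using \<zeta>(1) y01[of 0] by (simp_all add: y_def)
  then obtain \<rho> where \<rho>: "\<rho> ^ (d + 1) = 1" "\<rho> * (a + e)\<^sup>2 = (1 + \<rho>)\<^sup>2 * (a * e - b * c)"
    using eigenvalue_ratio_of_cycle[OF det, of y "d + 1"] cyc by metis
  have "square_defect d p q P Q = 0"
  proof (rule poly_eqI_degree[of "x ` X"])
    fix z assume "z \<in> x ` X"
    then obtain u where u: "u \<in> X" "z = x u" by blast
    have "\<zeta> * (\<zeta> * u ^ d) ^ d = (u ^ d) ^ d"
      using \<zeta>(1) by (simp add: power_mult_distrib)
    then have "rat_map d P Q (rat_map d P Q (Fin z)) = rat_map d p q (rat_map d p q (Fin z))"
      unfolding u(2) fx[OF u(1)] gx[OF u(1)] fx[OF Xd[OF u(1)]] gx[OF X\<zeta>[OF Xd[OF u(1)]]] by simp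
    then show "poly (square_defect d p q P Q) z = poly 0 z"
      using square_defect_iff[OF rp rP, of z] by simp
  next
    have "card X = ?N" unfolding X_def by (rule card_roots_unity_eq) (use d in simp)
    then have card: "card (x ` X) = ?N" using card_image[OF inj] by simp
    have hc: "degree (hom_comp d r s u) \<le> d * d" if "degree s \<le> d" "degree u \<le> d" for r s u
      using degree_hom_comp[OF that] .
    have "degree (square_defect d p q P Q) \<le> d * d + d * d"
      unfolding square_defect_def
      by (intro degree_diff_le order.trans[OF degree_mult_le] add_mono hc rat_pair_degrees[OF rp] rat_pair_degrees[OF rP])
    also have "\<dots> < card (x ` X)" unfolding card using d by simp
    finally show "degree (square_defect d p q P Q) < card (x ` X)" .
    then show "degree (0 :: complex poly) < card (x ` X)" by simp
  qed
  then show ?thesis using that P Q \<rho> by blast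
qed

section \<open>Twistedness as equations in the coefficients\<close>

text \<open>A minor of the coefficient matrix of \<open>p\<close> and \<open>q\<close>. By Cramer's rule such minors express the
  coordinates of a polynomial in the span of \<open>p\<close> and \<open>q\<close>.\<close>

definition cfdet :: "nat \<Rightarrow> nat \<Rightarrow> complex poly \<Rightarrow> complex poly \<Rightarrow> complex" where
  "cfdet i j p q = coeff p i * coeff q j - coeff p j * coeff q i"

lemma cfdet_linear:
  "cfdet i j (smult a p + smult b q) q = a * cfdet i j p q"
  "cfdet i j p (smult a p + smult b q) = b * cfdet i j p q"
  by (simp_all add: cfdet_def algebra_simps)

lemma cfdet_nonzero:
  assumes rp: "rat_pair d p q" and d: "d \<ge> 1"
  shows "\<exists>i j. cfdet i j p q \<noteq> 0"
proof (rule ccontr)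
  assume "\<not> ?thesis"
  then have 0: "cfdet i j p q = 0" for i j by blast
  have "coeff p j = 0 \<and> coeff q j = 0" for j
  proof -
    have "smult (coeff q j) p = smult (coeff p j) q"
    proof (rule poly_eqI)
      fix i show "coeff (smult (coeff q j) p) i = coeff (smult (coeff p j) q) i"
        using 0[of i j] by (simp add: cfdet_def mult.commute)
    qed
    then show ?thesis using rat_pair_independent[OF rp d] by blast
  qed
  then have "p = 0" "q = 0" by (auto intro: poly_eqI)
  then show False using rp by (simp add: rat_pair_def)
qed

text \<open>Twistedness, with the matrix of \<open>\<sigma>\<close> replaced by its multiple \<open>cfdet i j p q \<cdot> \<sigma>\<close>, whose entries
  are polynomials in the coefficients. The trace condition is homogeneous and thus not affected.\<close>

definition twist_equations :: "complex \<Rightarrow> nat \<Rightarrow> nat \<Rightarrow> nat \<Rightarrow> complex poly \<Rightarrow> complex poly \<Rightarrow> complex poly \<Rightarrow> complex poly \<Rightarrow> bool" where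
  "twist_equations \<zeta> d i j p q P Q \<longleftrightarrow>
     (\<forall>k\<le>d. cfdet i j p q * coeff P k = cfdet i j P q * coeff p k + cfdet i j p P * coeff q k) \<and>
     (\<forall>k\<le>d. cfdet i j p q * coeff Q k = cfdet i j Q q * coeff p k + cfdet i j p Q * coeff q k) \<and>
     \<zeta> * (cfdet i j P q + cfdet i j p Q)\<^sup>2
       = (1 + \<zeta>)\<^sup>2 * (cfdet i j P q * cfdet i j p Q - cfdet i j p P * cfdet i j Q q) \<and>
     (\<forall>z. poly (square_defect d p q P Q) z = 0)"

lemma twist_equations_if_matrix:
  assumes P: "P = smult a p + smult b q" and Q: "Q = smult c p + smult e q"
    and tr: "\<zeta> * (a + e)\<^sup>2 = (1 + \<zeta>)\<^sup>2 * (a * e - b * c)"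
    and sq: "\<And>z. poly (square_defect d p q P Q) z = 0"
  shows "twist_equations \<zeta> d i j p q P Q"
proof -
  let ?D = "cfdet i j p q"
  have m: "cfdet i j P q = a * ?D" "cfdet i j p P = b * ?D" "cfdet i j Q q = c * ?D" "cfdet i j p Q = e * ?D"
    unfolding P Q by (rule cfdet_linear)+
  have "\<zeta> * (a * ?D + e * ?D)\<^sup>2 = (\<zeta> * (a + e)\<^sup>2) * ?D\<^sup>2"
    by (simp add: power2_eq_square algebra_simps)
  also have "\<dots> = (1 + \<zeta>)\<^sup>2 * (a * ?D * (e * ?D) - b * ?D * (c * ?D))"
    unfolding tr by (simp add: power2_eq_square algebra_simps)
  finally show ?thesis unfolding twist_equations_def m using sq by (simp add: P Q algebra_simps)
qed

text \<open>A nonzero minor determines the matrix of \<open>\<sigma>\<close> up to a factor. Its invertibility is automatic,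
  since \<open>P\<close> and \<open>Q\<close> are linearly independent.\<close>

lemma twist_equations_iff:
  assumes rp: "rat_pair d p q" and rP: "rat_pair d P Q" and d: "d \<ge> 1" and D: "cfdet i j p q \<noteq> 0"
  shows "twisted_pair \<zeta> (rat_map d p q) (rat_map d P Q) \<longleftrightarrow> twist_equations \<zeta> d i j p q P Q"
proof
  assume "twisted_pair \<zeta> (rat_map d p q) (rat_map d P Q)"
  then obtain a b c e where det: "a * e - b * c \<noteq> 0" and tr: "\<zeta> * (a + e)\<^sup>2 = (1 + \<zeta>)\<^sup>2 * (a * e - b * c)"
    and g: "rat_map d P Q = mob a b c e \<circ> rat_map d p q"
    and sq: "\<And>z. poly (square_defect d p q P Q) z = 0"
    unfolding twisted_pair_def square_defect_iff[OF rp rP] by blast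
  note m = mob_rat_map[OF rp det]
  have "infinite {z. rat_map d (smult a p + smult b q) (smult c p + smult e q) (Fin z) = rat_map d P Q (Fin z)}"
    unfolding g m(1) by (simp add: infinite_UNIV_char_0)
  from rat_map_unique[OF m(2) rP this] obtain \<gamma>
    where "P = smult \<gamma> (smult a p + smult b q)" "Q = smult \<gamma> (smult c p + smult e q)" by blast
  then have PQ: "P = smult (\<gamma> * a) p + smult (\<gamma> * b) q" "Q = smult (\<gamma> * c) p + smult (\<gamma> * e) q"
    by (simp_all add: smult_add_right)
  have "\<zeta> * (\<gamma> * a + \<gamma> * e)\<^sup>2 = (\<zeta> * (a + e)\<^sup>2) * \<gamma>\<^sup>2" by (simp add: power2_eq_square algebra_simps)
  also have "\<dots> = (1 + \<zeta>)\<^sup>2 * (\<gamma> * a * (\<gamma> * e) - \<gamma> * b * (\<gamma> * c))"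
    unfolding tr by (simp add: power2_eq_square algebra_simps)
  finally show "twist_equations \<zeta> d i j p q P Q" by (rule twist_equations_if_matrix[OF PQ _ sq])
next
  assume tw: "twist_equations \<zeta> d i j p q P Q"
  let ?D = "cfdet i j p q"
  define a b c e where "a = cfdet i j P q" and "b = cfdet i j p P" and "c = cfdet i j Q q" and "e = cfdet i j p Q"
  have deg: "degree p \<le> d" "degree q \<le> d" "degree P \<le> d" "degree Q \<le> d"
    using rat_pair_degrees[OF rp] rat_pair_degrees[OF rP] by auto
  have P: "smult ?D P = smult a p + smult b q" and Q: "smult ?D Q = smult c p + smult e q"
  proof -
    have "coeff (smult ?D P) k = coeff (smult a p + smult b q) k \<and> coeff (smult ?D Q) k = coeff (smult c p + smult e q) k" for k
      using tw deg unfolding twist_equations_def a_def b_def c_def e_def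
      by (cases "k \<le> d") (auto simp: coeff_eq_0)
    then show "smult ?D P = smult a p + smult b q" "smult ?D Q = smult c p + smult e q"
      by (auto intro: poly_eqI)
  qed
  have det: "a * e - b * c \<noteq> 0"
  proof
    assume 0: "a * e - b * c = 0"
    have "smult e (smult ?D P) = smult b (smult ?D Q)" "smult c (smult ?D P) = smult a (smult ?D Q)"
      unfolding P Q using 0 by (simp_all add: smult_add_right mult_ac)
    then have "e * ?D = 0 \<and> b * ?D = 0" "c * ?D = 0 \<and> a * ?D = 0"
      using rat_pair_independent[OF rP d] by (metis smult_smult)+
    then have "a = 0" "b = 0" using D by auto
    then have "smult ?D P = smult 0 Q" using P by simp
    then show False using rat_pair_independent(1)[OF rP d] D by blast
  qed
  have "mob a b c e \<circ> rat_map d p q = rat_map d P Q"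
  proof
    fix x obtain X Y where X: "X \<noteq> 0 \<or> Y \<noteq> 0" "x = proj X Y" by (rule proj_cases)
    have hs: "hom_eval d (smult ?D r) X Y = ?D * hom_eval d r X Y" for r
      using hom_eval_linear[of d ?D r 0 0 X Y] by simp
    show "(mob a b c e \<circ> rat_map d p q) x = rat_map d P Q x"
      unfolding mob_rat_map(1)[OF rp det] P[symmetric] Q[symmetric] X(2)
      using D deg X(1) by (simp add: rat_map_proj hs order.trans[OF degree_smult_le] proj_scale)
  qed
  moreover have "\<zeta> * (a + e)\<^sup>2 = (1 + \<zeta>)\<^sup>2 * (a * e - b * c)"
    using tw unfolding twist_equations_def a_def b_def c_def e_def by blast
  moreover have "\<forall>z. rat_map d p q (rat_map d p q (Fin z)) = rat_map d P Q (rat_map d P Q (Fin z))"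
    using tw unfolding square_defect_iff[OF rp rP] twist_equations_def by blast
  ultimately show "twisted_pair \<zeta> (rat_map d p q) (rat_map d P Q)"
    unfolding twisted_pair_def using det by metis
qed

section \<open>Holomorphic families of rational maps\<close>

lemma isCont_imp_tendsto_nhds: "isCont f a \<Longrightarrow> (f \<longlongrightarrow> f a) (nhds a)"
  using tendsto_at_iff_tendsto_nhds[of f a] by (simp add: isCont_def)

lemma coeffs_holomorphic:
  assumes "\<And>t. t \<in> U \<Longrightarrow> degree (p t) \<le> d"
    and "\<And>i. i \<le> d \<Longrightarrow> (\<lambda>t. coeff (p t) i) holomorphic_on U"
  shows "(\<lambda>t. coeff (p t) i) holomorphic_on U"
proof (cases "i \<le> d")
  case False
  have "(\<lambda>t. coeff (p t) i) holomorphic_on U \<longleftrightarrow> (\<lambda>t. 0) holomorphic_on U"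
    using False assms(1) by (intro holomorphic_cong refl coeff_eq_0) (meson not_le le_less_trans)
  then show ?thesis by (simp add: holomorphic_on_const)
qed (rule assms(2))

lemma holomorphic_poly_family:
  assumes "\<And>t. t \<in> U \<Longrightarrow> degree (p t) \<le> d"
    and "\<And>i. i \<le> d \<Longrightarrow> (\<lambda>t. coeff (p t) i) holomorphic_on U" "h holomorphic_on U"
  shows "(\<lambda>t. poly (p t) (h t)) holomorphic_on U"
proof -
  have "(\<lambda>t. hom_eval d (p t) (h t) 1) holomorphic_on U"
    unfolding hom_eval_def using assms(2,3) by (intro holomorphic_intros) auto
  then show ?thesis
    by (rule holomorphic_transform) (simp add: hom_eval_affine assms(1))
qed

text \<open>Homogeneous coordinates over all of \<open>U\<close>, as they occur in \<open>holomorphic_to_Rat\<close>.\<close>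

definition rat_chart :: "nat \<Rightarrow> (complex \<Rightarrow> P1 \<Rightarrow> P1) \<Rightarrow> complex set \<Rightarrow> (complex \<Rightarrow> complex poly) \<Rightarrow>
    (complex \<Rightarrow> complex poly) \<Rightarrow> bool" where
  "rat_chart d f U p q \<longleftrightarrow>
     (\<forall>i\<le>d. (\<lambda>t. coeff (p t) i) holomorphic_on U \<and> (\<lambda>t. coeff (q t) i) holomorphic_on U) \<and>
     (\<forall>t\<in>U. rat_pair d (p t) (q t) \<and> f t = rat_map d (p t) (q t))"

lemma rat_chartD:
  assumes "rat_chart d f U p q"
  shows "t \<in> U \<Longrightarrow> rat_pair d (p t) (q t)" "t \<in> U \<Longrightarrow> f t = rat_map d (p t) (q t)"
    "i \<le> d \<Longrightarrow> (\<lambda>t. coeff (p t) i) holomorphic_on U" "i \<le> d \<Longrightarrow> (\<lambda>t. coeff (q t) i) holomorphic_on U"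
  using assms by (auto simp: rat_chart_def)

lemma rat_chart_subset:
  "rat_chart d f U p q \<Longrightarrow> V \<subseteq> U \<Longrightarrow> rat_chart d f V p q"
  unfolding rat_chart_def by (meson holomorphic_on_subset subsetD)

section \<open>Perturbations of a power map near the unit circle\<close>

lemma tendsto_poly_family:
  assumes deg: "\<forall>\<^sub>F t in nhds t0. degree (p t) \<le> d"
    and cont: "\<And>i. isCont (\<lambda>t. coeff (p t) i) t0"
  shows "((\<lambda>(t, z). poly (p t) z) \<longlongrightarrow> poly (p t0) a) (nhds t0 \<times>\<^sub>F nhds (a :: complex))"
proof -
  have alt: "poly r z = (\<Sum>i\<le>d. coeff r i * z ^ i)" if "degree r \<le> d" for r :: "complex poly" and z
    using hom_eval_affine[OF that, of z] by (simp add: hom_eval_def)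
  have "((\<lambda>x. \<Sum>i\<le>d. coeff (p (fst x)) i * snd x ^ i) \<longlongrightarrow> (\<Sum>i\<le>d. coeff (p t0) i * a ^ i))
      (nhds t0 \<times>\<^sub>F nhds a)"
  proof (intro tendsto_intros)
    show "((\<lambda>x. coeff (p (fst x)) i) \<longlongrightarrow> coeff (p t0) i) (nhds t0 \<times>\<^sub>F nhds a)" for i
      by (rule filterlim_compose[OF _ filterlim_fst])
        (use cont[of i] tendsto_at_iff_tendsto_nhds[of "\<lambda>t. coeff (p t) i" t0] in \<open>simp add: isCont_def\<close>)
    show "(snd \<longlongrightarrow> a) (nhds t0 \<times>\<^sub>F nhds a)" by (rule filterlim_snd)
  qed
  also have "(\<Sum>i\<le>d. coeff (p t0) i * a ^ i) = poly (p t0) a"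
    using alt eventually_nhds_x_imp_x[OF deg] by simp
  finally show ?thesis
  proof (rule Lim_transform_eventually)
    have "\<forall>\<^sub>F x in nhds t0 \<times>\<^sub>F nhds a. degree (p (fst x)) \<le> d"
      using eventually_compose_filterlim[OF deg filterlim_fst] .
    then show "\<forall>\<^sub>F x in nhds t0 \<times>\<^sub>F nhds a. (\<Sum>i\<le>d. coeff (p (fst x)) i * snd x ^ i) = (case x of (t, z) \<Rightarrow> poly (p t) z)"
      by eventually_elim (auto simp: alt)
  qed
qed

text \<open>The derivative of \<open>p / q\<close> is jointly continuous in the parameter and the point, and equals \<open>c\<close> at
  \<open>(0, a)\<close>. On a small ball the map therefore differs from its linear part by a contraction. For
  \<open>d \<ge> 2\<close> and \<open>\<bar>a\<bar> = \<bar>k\<bar> = 1\<close> one has \<open>\<bar>c\<bar> = d \<ge> 2\<close>, which makes the map expanding.\<close>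

lemma near_power_map_linearised:
  fixes p q :: "complex \<Rightarrow> complex poly" and a k m :: complex
  assumes deg: "\<forall>\<^sub>F t in nhds 0. degree (p t) \<le> d \<and> degree (q t) \<le> d"
    and cp: "\<And>i. isCont (\<lambda>t. coeff (p t) i) 0" and cq: "\<And>i. isCont (\<lambda>t. coeff (q t) i) 0"
    and p0: "p 0 = monom (k * m) d" and q0: "q 0 = [:m:]" and m: "m \<noteq> 0"
  defines "c \<equiv> of_nat d * k * a ^ (d - 1)"
  shows "\<exists>e>0. \<forall>t\<in>ball 0 e. \<forall>u\<in>cball a e. poly (q t) u \<noteq> 0 \<and>
    (\<forall>v\<in>cball a e. norm (poly (p t) u / poly (q t) u - poly (p t) v / poly (q t) v - c * (u - v)) \<le> 1 / 4 * norm (u - v))"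
proof -
  let ?F = "nhds 0 \<times>\<^sub>F nhds a"
  define D where "D = (\<lambda>(t, z). (poly (pderiv (p t)) z * poly (q t) z - poly (p t) z * poly (pderiv (q t)) z)
     / (poly (q t) z * poly (q t) z))"
  have degp: "\<forall>\<^sub>F t in nhds 0. degree (p t) \<le> d" and degq: "\<forall>\<^sub>F t in nhds 0. degree (q t) \<le> d"
    using deg by (auto elim: eventually_mono)
  have dd: "\<forall>\<^sub>F t in nhds 0. degree (pderiv (r t)) \<le> d"
    if "\<forall>\<^sub>F t in nhds 0. degree (r t) \<le> d" for r :: "complex \<Rightarrow> complex poly"
    using that by eventually_elim (simp add: degree_pderiv)
  have cd: "isCont (\<lambda>t. coeff (pderiv (r t)) i) 0" if "\<And>i. isCont (\<lambda>t. coeff (r t) i) 0"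
    for r :: "complex \<Rightarrow> complex poly" and i
    unfolding coeff_pderiv using that[of "Suc i"] by (intro continuous_intros)
  note lp = tendsto_poly_family[OF degp cp, of a] and lq = tendsto_poly_family[OF degq cq, of a]
    and lp' = tendsto_poly_family[OF dd[OF degp] cd[OF cp], of a]
    and lq' = tendsto_poly_family[OF dd[OF degq] cd[OF cq], of a]
  have lim: "(D \<longlongrightarrow> (poly (pderiv (p 0)) a * poly (q 0) a - poly (p 0) a * poly (pderiv (q 0)) a)
     / (poly (q 0) a * poly (q 0) a)) ?F"
    unfolding D_def case_prod_unfold using m
    by (intro tendsto_intros lp[unfolded case_prod_unfold] lq[unfolded case_prod_unfold]
      lp'[unfolded case_prod_unfold] lq'[unfolded case_prod_unfold]) (simp add: q0)
  have "(D \<longlongrightarrow> c) ?F"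
    using lim m by (simp add: p0 q0 c_def pderiv_monom poly_monom pderiv_pCons field_simps)
  then have e1: "\<forall>\<^sub>F x in ?F. dist (D x) c < 1 / 4" by (rule tendstoD) simp
  have e2: "\<forall>\<^sub>F x in ?F. (case x of (t, z) \<Rightarrow> poly (q t) z) \<noteq> 0"
    using lq by (rule tendsto_imp_eventually_ne) (simp add: q0 m)
  have "\<forall>\<^sub>F x in nhds (0, a). dist (D x) c < 1 / 4 \<and> (case x of (t, z) \<Rightarrow> poly (q t) z) \<noteq> 0"
    unfolding nhds_prod using e1 e2 by eventually_elim simp
  then obtain e where e: "e > 0" "\<And>x. dist x (0, a) < e \<Longrightarrow>
     dist (D x) c < 1 / 4 \<and> (case x of (t, z) \<Rightarrow> poly (q t) z) \<noteq> 0"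
    unfolding eventually_nhds_metric by blast
  have near: "dist (D (t, z)) c < 1 / 4 \<and> poly (q t) z \<noteq> 0" if "t \<in> ball 0 (e / 2)" "z \<in> cball a (e / 3)" for t z
  proof -
    have "dist (t, z) (0, a) \<le> dist t 0 + dist z a"
      by (simp add: dist_prod_def sqrt_sum_squares_le_sum)
    also have "\<dots> < e" using that e(1) by (simp add: dist_commute)
    finally show ?thesis using e(2) by force
  qed
  show ?thesis
  proof (intro exI[of _ "e / 3"] conjI ballI)
    show "e / 3 > 0" using e by simp
    fix t u :: complex assume t: "t \<in> ball 0 (e / 3)" and u: "u \<in> cball a (e / 3)"
    then have t': "t \<in> ball 0 (e / 2)" using e(1) by auto
    show "poly (q t) u \<noteq> 0" using near t' u by blast
    fix v assume v: "v \<in> cball a (e / 3)"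
    let ?h = "\<lambda>z. poly (p t) z / poly (q t) z - c * z"
    have "norm (?h u - ?h v) \<le> 1 / 4 * norm (u - v)"
    proof (rule field_differentiable_bound[OF convex_cball _ _ u v])
      fix z assume z: "z \<in> cball a (e / 3)"
      show "(?h has_field_derivative D (t, z) - c) (at z within cball a (e / 3))"
        unfolding D_def prod.case using near[OF t' z]
        by (auto intro!: derivative_eq_intros poly_DERIV)
      show "norm (D (t, z) - c) \<le> 1 / 4" using near[OF t' z] by (simp add: dist_norm)
    qed
    then show "norm (poly (p t) u / poly (q t) u - poly (p t) v / poly (q t) v - c * (u - v)) \<le> 1 / 4 * norm (u - v)"
      by (simp add: algebra_simps)
  qed
qed

lemma expansion_of_linearised:
  fixes u v c :: complex
  assumes "norm (x - y - c * (u - v)) \<le> 1 / 4 * norm (u - v)" "norm c \<ge> 2"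
  shows "norm (x - y) \<ge> 7 / 4 * norm (u - v)"
proof -
  have "norm (c * (u - v)) \<le> norm (x - y) + norm (x - y - c * (u - v))"
    using norm_triangle_ineq4[of "x - y" "x - y - c * (u - v)"] by simp
  moreover have "norm (c * (u - v)) \<ge> 2 * norm (u - v)"
    unfolding norm_mult using assms(2) by (intro mult_right_mono) auto
  ultimately show ?thesis using assms(1) by simp
qed

text \<open>All points of the portrait are found at once as the fixed point of the iteration
  \<open>y a \<mapsto> y a - (\<phi> t (y a) - y (s a)) / c a\<close> started at \<open>y a = a\<close>. It contracts with factor
  \<open>5 / 8 = (1 + 1 / 4) / 2\<close>: the linearisation error contributes \<open>1 / 4\<close>, the neighbour \<open>y (s a)\<close>
  contributes \<open>1\<close>, and both are divided by \<open>\<bar>c a\<bar> \<ge> 2\<close>. Every iterate is holomorphic, so the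
  uniform limit is.\<close>

lemma holomorphic_shadowing:
  fixes X :: "complex set" and s :: "complex \<Rightarrow> complex" and \<phi> :: "complex \<Rightarrow> complex \<Rightarrow> complex"
  assumes U: "open U" "t0 \<in> U" and \<delta>: "\<delta> > 0"
    and sX: "\<And>a. a \<in> X \<Longrightarrow> s a \<in> X"
    and c: "\<And>a. a \<in> X \<Longrightarrow> norm (c a) \<ge> 2"
    and lin: "\<And>t a u v. t \<in> U \<Longrightarrow> a \<in> X \<Longrightarrow> u \<in> cball a \<delta> \<Longrightarrow> v \<in> cball a \<delta> \<Longrightarrow>
       norm (\<phi> t u - \<phi> t v - c a * (u - v)) \<le> 1 / 4 * norm (u - v)"
    and start: "\<And>t a. t \<in> U \<Longrightarrow> a \<in> X \<Longrightarrow> norm (\<phi> t a - s a) \<le> \<delta> / 4"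
    and hol: "\<And>a h. a \<in> X \<Longrightarrow> h holomorphic_on U \<Longrightarrow> h ` U \<subseteq> cball a \<delta> \<Longrightarrow> (\<lambda>t. \<phi> t (h t)) holomorphic_on U"
    and base: "\<And>a. a \<in> X \<Longrightarrow> \<phi> t0 a = s a"
  obtains x where "\<And>a. a \<in> X \<Longrightarrow> x a holomorphic_on U" "\<And>a. a \<in> X \<Longrightarrow> x a t0 = a"
    "\<And>a t. a \<in> X \<Longrightarrow> t \<in> U \<Longrightarrow> x a t \<in> cball a (\<delta> / 2)"
    "\<And>a t. a \<in> X \<Longrightarrow> t \<in> U \<Longrightarrow> \<phi> t (x a t) = x (s a) t"
proof -
  define y where "y = rec_nat (\<lambda>a t. a) (\<lambda>_ y a t. y a t - (\<phi> t (y a t) - y (s a) t) / c a)"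
  have y0: "y 0 a t = a" and yS: "y (Suc n) a t = y n a t - (\<phi> t (y n a t) - y n (s a) t) / c a" for n a t
    by (simp_all add: y_def)
  let ?q = "5 / 8 :: real"
  have est: "norm (y n a t - a) \<le> \<delta> / 3 * (1 - ?q ^ n) \<and> norm (y (Suc n) a t - y n a t) \<le> \<delta> / 8 * ?q ^ n"
    if "a \<in> X" "t \<in> U" for n a t
    using that
  proof (induction n arbitrary: a)
    case 0
    have "norm ((\<phi> t a - s a) / c a) \<le> (\<delta> / 4) / 2"
      unfolding norm_divide using start[OF 0(2,1)] c[OF 0(1)] \<delta> by (intro frac_le) auto
    then show ?case by (simp add: yS y0 norm_minus_commute)
  next
    case (Suc n)
    note IH = Suc.IH[OF Suc.prems] and IH' = Suc.IH[OF sX[OF Suc.prems(1)] Suc.prems(2)]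
    have "norm (y (Suc n) a t - a) \<le> norm (y (Suc n) a t - y n a t) + norm (y n a t - a)"
      using norm_triangle_ineq[of "y (Suc n) a t - y n a t" "y n a t - a"] by simp
    also have "\<dots> \<le> \<delta> / 8 * ?q ^ n + \<delta> / 3 * (1 - ?q ^ n)" using IH by (intro add_mono) auto
    also have "\<dots> = \<delta> / 3 * (1 - ?q ^ Suc n)" by (simp add: field_simps)
    finally have one: "norm (y (Suc n) a t - a) \<le> \<delta> / 3 * (1 - ?q ^ Suc n)" .
    have small: "\<delta> / 3 * (1 - ?q ^ j) \<le> \<delta>" for j
    proof -
      have "\<delta> / 3 * (1 - ?q ^ j) \<le> \<delta> / 3 * 1" using \<delta> by (intro mult_left_mono) auto
      then show ?thesis using \<delta> by linarith
    qed
    have in1: "y (Suc n) a t \<in> cball a \<delta>" "y n a t \<in> cball a \<delta>"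
      using one IH small[of n] small[of "Suc n"] by (auto simp: dist_norm norm_minus_commute)
    let ?A = "y (Suc n) a t" and ?B = "y n a t" and ?A' = "y (Suc n) (s a) t" and ?B' = "y n (s a) t"
    have c0: "c a \<noteq> 0" using c[OF Suc.prems(1)] by auto
    have "y (Suc (Suc n)) a t - ?A = (?A - ?B) - (\<phi> t ?A - \<phi> t ?B) / c a + (?A' - ?B') / c a"
      by (subst (1) yS, subst (3) yS) (simp add: diff_divide_distrib)
    also have "\<dots> = (?A' - ?B') / c a - (\<phi> t ?A - \<phi> t ?B - c a * (?A - ?B)) / c a"
      using c0 by (simp add: field_simps)
    finally have "norm (y (Suc (Suc n)) a t - ?A)
        \<le> norm ((?A' - ?B') / c a) + norm ((\<phi> t ?A - \<phi> t ?B - c a * (?A - ?B)) / c a)"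
      by (simp only: norm_triangle_ineq4)
    also have "\<dots> \<le> (\<delta> / 8 * ?q ^ n) / 2 + (1 / 4 * (\<delta> / 8 * ?q ^ n)) / 2"
      unfolding norm_divide
    proof (intro add_mono frac_le)
      show "norm (\<phi> t ?A - \<phi> t ?B - c a * (?A - ?B)) \<le> 1 / 4 * (\<delta> / 8 * ?q ^ n)"
        using lin[OF Suc.prems(2,1) in1] IH by simp
    qed (use IH' c[OF Suc.prems(1)] \<delta> in auto)
    also have "\<dots> = \<delta> / 8 * ?q ^ Suc n" by (simp add: field_simps)
    finally show ?case using one by simp
  qed
  define x where "x a t = a + (\<Sum>n. y (Suc n) a t - y n a t)" for a t
  have tele: "y n a t = a + (\<Sum>i<n. y (Suc i) a t - y i a t)" for n a t
    by (induction n) (simp_all add: y0)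
  have unif: "uniform_limit U (\<lambda>n. y n a) (x a) sequentially" if "a \<in> X" for a
  proof -
    have "uniform_limit U (\<lambda>n t. \<Sum>i<n. y (Suc i) a t - y i a t) (\<lambda>t. \<Sum>n. y (Suc n) a t - y n a t) sequentially"
    proof (rule Weierstrass_m_test)
      show "summable (\<lambda>n. \<delta> / 8 * ?q ^ n)" by (intro summable_mult summable_geometric) simp
    qed (use est that in blast)
    then have "uniform_limit U (\<lambda>n t. a + (\<Sum>i<n. y (Suc i) a t - y i a t)) (\<lambda>t. a + (\<Sum>n. y (Suc n) a t - y n a t)) sequentially"
      by (intro uniform_limit_intros)
    then show ?thesis by (simp add: x_def[abs_def] flip: tele)
  qed
  have lim: "(\<lambda>n. y n a t) \<longlonglongrightarrow> x a t" if "a \<in> X" "t \<in> U" for a t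
    using tendsto_uniform_limitI[OF unif that(2)] that by blast
  have third: "norm (y n a t - a) \<le> \<delta> / 3" if "a \<in> X" "t \<in> U" for n a t
  proof -
    have "\<delta> / 3 * (1 - ?q ^ n) \<le> \<delta> / 3 * 1" using \<delta> by (intro mult_left_mono) auto
    then show ?thesis using est[OF that, of n] by simp
  qed
  have xin: "x a t \<in> cball a (\<delta> / 2)" if "a \<in> X" "t \<in> U" for a t
  proof (rule Lim_in_closed_set[OF closed_cball _ _ lim[OF that]])
    have "y n a t \<in> cball a (\<delta> / 2)" for n
      using third[OF that, of n] \<delta> by (simp add: dist_norm norm_minus_commute)
    then show "\<forall>\<^sub>F n in sequentially. y n a t \<in> cball a (\<delta> / 2)" by simp
  qed simp
  have yhol: "y n a holomorphic_on U" if "a \<in> X" for n a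
    using that
  proof (induction n arbitrary: a)
    case 0
    then show ?case by (simp add: y0[abs_def] holomorphic_on_const)
  next
    case (Suc n)
    have "y n a ` U \<subseteq> cball a \<delta>"
    proof (rule image_subsetI)
      fix t assume "t \<in> U"
      from third[OF Suc.prems this, of n] show "y n a t \<in> cball a \<delta>"
        using \<delta> by (simp add: dist_norm norm_minus_commute)
    qed
    then have "(\<lambda>t. \<phi> t (y n a t)) holomorphic_on U"
      by (rule hol[OF Suc.prems Suc.IH[OF Suc.prems]])
    moreover have "c a \<noteq> 0" using c[OF Suc.prems] by auto
    ultimately have "(\<lambda>t. y n a t - (\<phi> t (y n a t) - y n (s a) t) / c a) holomorphic_on U"
      using Suc.IH[OF Suc.prems] Suc.IH[OF sX[OF Suc.prems]] by (intro holomorphic_intros) auto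
    then show ?case by (simp add: yS[abs_def])
  qed
  show ?thesis
  proof
    show "x a holomorphic_on U" if "a \<in> X" for a
    proof (rule holomorphic_uniform_sequence[OF U(1) yhol[OF that]])
      fix t assume "t \<in> U"
      then obtain e where "e > 0" "cball t e \<subseteq> U" using U(1) open_contains_cball by blast
      then show "\<exists>e>0. cball t e \<subseteq> U \<and> uniform_limit (cball t e) (\<lambda>n. y n a) (x a) sequentially"
        using uniform_limit_on_subset[OF unif[OF that]] by blast
    qed
    show "x a t0 = a" if "a \<in> X" for a
    proof -
      have "y n a t0 = a" if "a \<in> X" for n a
        using that by (induction n arbitrary: a) (simp_all add: y0 yS base sX)
      then show ?thesis using lim[OF that U(2)] that by (simp add: LIMSEQ_const_iff)
    qed
    show "x a t \<in> cball a (\<delta> / 2)" if "a \<in> X" "t \<in> U" for a t using xin that by blast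
    show "\<phi> t (x a t) = x (s a) t" if at: "a \<in> X" "t \<in> U" for a t
    proof -
      have c0: "c a \<noteq> 0" using c[OF at(1)] by auto
      have xd: "x a t \<in> cball a \<delta>" and yd: "y n a t \<in> cball a \<delta>" for n
        using xin[OF at] third[OF at, of n] \<delta> by (auto simp: dist_norm norm_minus_commute)
      have "(\<lambda>n. \<phi> t (y n a t) - \<phi> t (x a t) - c a * (y n a t - x a t)) \<longlonglongrightarrow> 0"
      proof (rule Lim_null_comparison)
        show "\<forall>\<^sub>F n in sequentially. norm (\<phi> t (y n a t) - \<phi> t (x a t) - c a * (y n a t - x a t)) \<le> 1 / 4 * norm (y n a t - x a t)"
          using lin[OF at(2,1) yd xd] by simp
        show "(\<lambda>n. 1 / 4 * norm (y n a t - x a t)) \<longlonglongrightarrow> 0"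
          using lim[OF at] by (auto intro!: tendsto_eq_intros)
      qed
      moreover have "(\<lambda>n. c a * (y n a t - x a t)) \<longlonglongrightarrow> 0" using lim[OF at] by (auto intro!: tendsto_eq_intros)
      ultimately have "(\<lambda>n. (\<phi> t (y n a t) - \<phi> t (x a t) - c a * (y n a t - x a t)) + c a * (y n a t - x a t)) \<longlonglongrightarrow> 0 + 0"
        by (rule tendsto_add)
      then have l1: "(\<lambda>n. \<phi> t (y n a t) - \<phi> t (x a t)) \<longlonglongrightarrow> 0" by simp
      have "(\<lambda>n. c a * (y (Suc n) a t - y n a t)) \<longlonglongrightarrow> c a * (x a t - x a t)"
        by (intro tendsto_intros lim[OF at] LIMSEQ_Suc)
      moreover have "c a * (y (Suc n) a t - y n a t) = y n (s a) t - \<phi> t (y n a t)" for n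
        using c0 by (simp add: yS field_simps)
      ultimately have "(\<lambda>n. y n (s a) t - \<phi> t (y n a t)) \<longlonglongrightarrow> 0" by simp
      from tendsto_add[OF this l1] have "(\<lambda>n. y n (s a) t - \<phi> t (x a t)) \<longlonglongrightarrow> 0" by simp
      moreover have "(\<lambda>n. y n (s a) t - \<phi> t (x a t)) \<longlonglongrightarrow> x (s a) t - \<phi> t (x a t)"
        by (intro tendsto_intros lim sX at)
      ultimately show ?thesis using LIMSEQ_unique by fastforce
    qed
  qed
qed

section \<open>Expanding orbits lie in the Julia set\<close>

lemma isCont_Fin: "isCont Fin z"
proof -
  have nz: "1 + (cmod z)\<^sup>2 \<noteq> 0" using zero_le_power2[of "cmod z"] by linarith
  have "((\<lambda>w. stereo (Fin w)) \<longlongrightarrow> stereo (Fin z)) (at z)"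
    unfolding stereo.simps using nz by (intro tendsto_intros) auto
  then show ?thesis unfolding isCont_def tendsto_iff dist_P1_def .
qed

lemma continuous_on_Fin: "continuous_on S Fin"
  by (intro continuous_at_imp_continuous_on ballI isCont_Fin)

text \<open>The affine chart is open for the chordal metric: \<open>h\<close> in the proof is stereographic projection.\<close>

lemma near_Fin_is_Fin:
  assumes "\<delta> > 0"
  obtains \<epsilon> where "\<epsilon> > 0" "\<And>y. dist y (Fin z) < \<epsilon> \<Longrightarrow> \<exists>w. y = Fin w \<and> dist w z < \<delta>"
proof -
  define h :: "complex \<times> real \<Rightarrow> complex" where "h = (\<lambda>s. fst s / of_real (1 - snd s))"
  have nz: "1 + (cmod w)\<^sup>2 \<noteq> 0" for w using zero_le_power2[of "cmod w"] by linarith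
  have s1: "1 - snd (stereo (Fin w)) = 2 / (1 + (cmod w)\<^sup>2)" for w
    using nz[of w] by (simp add: field_simps)
  have h: "h (stereo (Fin w)) = w" for w
    unfolding h_def s1 using nz[of w] by (simp add: complex_eq_iff)
  have nn: "of_real (1 - snd (stereo (Fin z))) \<noteq> (0 :: complex)"
    unfolding s1 of_real_eq_0_iff using nz[of z] by simp
  have "isCont h (stereo (Fin z))"
    unfolding h_def by (intro continuous_intros nn)
  then obtain e where e: "e > 0" "\<And>s. dist s (stereo (Fin z)) < e \<Longrightarrow> dist (h s) (h (stereo (Fin z))) < \<delta>"
    using assms unfolding continuous_at_eps_delta by blast
  show ?thesis
  proof (rule that[of "min e (dist Infty (Fin z))"])
    show "min e (dist Infty (Fin z)) > 0" using e(1) by simp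
    fix y assume y: "dist y (Fin z) < min e (dist Infty (Fin z))"
    then obtain w where w: "y = Fin w" by (cases y) auto
    have "dist (stereo (Fin w)) (stereo (Fin z)) < e" using y w by (simp add: dist_P1_def)
    from e(2)[OF this] show "\<exists>w. y = Fin w \<and> dist w z < \<delta>" unfolding h using w by blast
  qed
qed

text \<open>The limit is close to one fixed member of the sequence, which is continuous; an \<open>\<epsilon> / 5\<close> argument
  carries this over to all later members.\<close>

lemma normal_family_equicontinuous_subsequence:
  fixes h :: "nat \<Rightarrow> P1 \<Rightarrow> P1"
  assumes norm: "normal_family_on U F" and h: "range h \<subseteq> F"
    and K: "compact K" "K \<subseteq> U" "x \<in> K" and cont: "\<And>n. isCont (h n) x" and e: "e > 0"
  shows "\<exists>(r :: nat \<Rightarrow> nat) k. \<exists>\<eta>>0. strict_mono r \<and>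
    (\<forall>j\<ge>k. \<forall>y\<in>K. dist y x < \<eta> \<longrightarrow> dist (h (r j) y) (h (r j) x) < e)"
proof -
  obtain r l where r: "strict_mono (r :: nat \<Rightarrow> nat)" and "uniform_limit K (h \<circ> r) l sequentially"
    using norm h K(1,2) unfolding normal_family_on_def by blast
  then have "\<forall>\<^sub>F j in sequentially. \<forall>y\<in>K. dist ((h \<circ> r) j y) (l y) < e / 5"
    using e unfolding uniform_limit_iff by (meson divide_pos_pos zero_less_numeral)
  then obtain k where k: "\<And>j y. j \<ge> k \<Longrightarrow> y \<in> K \<Longrightarrow> dist (h (r j) y) (l y) < e / 5"
    unfolding eventually_sequentially by auto
  obtain \<eta> where \<eta>: "\<eta> > 0" "\<And>y. dist y x < \<eta> \<Longrightarrow> dist (h (r k) y) (h (r k) x) < e / 5"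
    using cont[of "r k"] e unfolding continuous_at_eps_delta
    by (meson divide_pos_pos zero_less_numeral)
  show ?thesis
  proof (intro exI[of _ r] exI[of _ k] exI[of _ \<eta>] conjI r \<eta>(1) allI impI ballI)
    fix j y assume jy: "k \<le> j" "y \<in> K" "dist y x < \<eta>"
    have "dist (h (r j) y) (l y) < e / 5" "dist (h (r k) y) (l y) < e / 5"
      "dist (h (r j) x) (l x) < e / 5" "dist (h (r k) x) (l x) < e / 5"
      "dist (h (r k) y) (h (r k) x) < e / 5"
      using k jy K(3) \<eta>(2) by auto
    then show "dist (h (r j) y) (h (r j) x) < e"
      using dist_triangle[of "h (r j) y" "h (r j) x" "l y"] dist_triangle[of "l y" "h (r j) x" "h (r k) y"]
        dist_triangle[of "h (r k) y" "h (r j) x" "h (r k) x"] dist_triangle[of "h (r k) x" "h (r j) x" "l x"]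
      by (simp add: dist_commute)
  qed
qed

text \<open>Every point near \<open>x 0\<close> but different from it eventually leaves the \<open>\<delta>\<close>-neighbourhood of the orbit,
  since its distance from the orbit grows by a factor \<open>7 / 4\<close> as long as it stays inside. Iterates
  chosen at such escape times, for points converging to \<open>x 0\<close>, have no equicontinuous subsequence.
  Finiteness of the orbit makes the escape uniform in the chordal metric.\<close>

lemma expanding_orbit_in_Julia:
  fixes F :: "P1 \<Rightarrow> P1" and x :: "nat \<Rightarrow> complex"
  assumes orbit: "\<And>n. F (Fin (x n)) = Fin (x (Suc n))" and fin: "finite (range x)"
    and cont: "\<And>n. isCont F (Fin (x n))" and \<delta>: "\<delta> > 0"
    and expand: "\<And>n w. w \<in> cball (x n) \<delta> \<Longrightarrow>
       \<exists>w'. F (Fin w) = Fin w' \<and> norm (w' - x (Suc n)) \<ge> 7 / 4 * norm (w - x n)"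
  shows "Fin (x 0) \<in> Julia F"
proof (rule ccontr)
  assume "Fin (x 0) \<notin> Julia F"
  then obtain U where U: "open U" "Fin (x 0) \<in> U" "normal_family_on U (range (\<lambda>n. F ^^ n))"
    by (auto simp: Julia_def Fatou_def)
  have orb: "(F ^^ n) (Fin (x 0)) = Fin (x n)" for n
    by (induction n) (simp_all add: orbit)
  have contn: "isCont (F ^^ n) (Fin (x 0))" for n
  proof (induction n)
    case (Suc n)
    have "isCont F ((F ^^ n) (Fin (x 0)))" unfolding orb by (rule cont)
    with Suc have "isCont (F \<circ> (F ^^ n)) (Fin (x 0))" by (intro continuous_at_compose)
    then show ?case by (simp only: funpow.simps)
  qed simp
  have "open (Fin -` U)" using U(1) continuous_on_Fin by (rule open_vimage)
  then obtain \<rho> where \<rho>: "\<rho> > 0" "cball (x 0) \<rho> \<subseteq> Fin -` U"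
    using U(2) open_contains_cball by (metis vimageI)
  define K where "K = Fin ` cball (x 0) \<rho>"
  have K: "compact K" "K \<subseteq> U" "Fin (x 0) \<in> K"
    using \<rho> compact_continuous_image[OF continuous_on_Fin compact_cball] by (auto simp: K_def)
  have "\<exists>\<epsilon>>0. \<forall>y. dist y (Fin z) < \<epsilon> \<longrightarrow> (\<exists>w. y = Fin w \<and> dist w z < \<delta>)" for z
    using near_Fin_is_Fin[OF \<delta>, of z] by metis
  then obtain E where E: "\<And>z. E z > 0" "\<And>z y. dist y (Fin z) < E z \<Longrightarrow> \<exists>w. y = Fin w \<and> dist w z < \<delta>"
    by metis
  define \<epsilon> where "\<epsilon> = Min (E ` range x)"
  have \<epsilon>: "\<epsilon> > 0" "\<And>n. \<epsilon> \<le> E (x n)" using fin E(1) by (auto simp: \<epsilon>_def)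
  have escape: "\<exists>n. \<not> dist ((F ^^ n) (Fin w)) (Fin (x n)) < \<epsilon>" if "w \<noteq> x 0" for w
  proof (rule ccontr)
    assume "\<not> ?thesis"
    then have close: "\<exists>v. (F ^^ n) (Fin w) = Fin v \<and> dist v (x n) < \<delta>" for n
      using E(2) \<epsilon>(2)[of n] by (meson less_le_trans)
    have grow: "\<exists>v. (F ^^ n) (Fin w) = Fin v \<and> norm (v - x n) \<ge> (7 / 4) ^ n * norm (w - x 0)" for n
    proof (induction n)
      case (Suc n)
      then obtain v where v: "(F ^^ n) (Fin w) = Fin v" "norm (v - x n) \<ge> (7 / 4) ^ n * norm (w - x 0)" by blast
      have "v \<in> cball (x n) \<delta>" using close[of n] v(1) by (auto simp: dist_commute)
      from expand[OF this] obtain w' where w': "F (Fin v) = Fin w'" "norm (w' - x (Suc n)) \<ge> 7 / 4 * norm (v - x n)"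
        by blast
      then show ?case using v by (intro exI[of _ w']) simp
    qed simp
    have "norm (w - x 0) > 0" using that by simp
    then obtain n where "(7 / 4) ^ n > \<delta> / norm (w - x 0)"
      using real_arch_pow[of "7 / 4" "\<delta> / norm (w - x 0)"] by auto
    then have "(7 / 4) ^ n * norm (w - x 0) > \<delta>" using \<open>norm (w - x 0) > 0\<close> by (simp add: field_simps)
    then show False using grow[of n] close[of n] by (auto simp: dist_norm)
  qed
  \<comment> \<open>Any sequence that tends to \<open>x 0\<close> inside the disk without reaching it will do.\<close>
  define w where "w j = x 0 + of_real (\<rho> / of_nat (Suc j))" for j
  have w0: "w j \<noteq> x 0" for j using \<rho> by (simp add: w_def del: of_nat_Suc)
  have wK: "Fin (w j) \<in> K" for j
  proof -
    have "\<rho> / of_nat (Suc j) \<le> \<rho>" using \<rho> by (simp add: field_simps)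
    then show ?thesis using \<rho> by (auto simp: K_def w_def dist_norm norm_divide simp del: of_nat_Suc)
  qed
  have "(\<lambda>j. \<rho> / of_nat (Suc j)) \<longlonglongrightarrow> 0" by (rule LIMSEQ_Suc[OF lim_const_over_n])
  then have "w \<longlonglongrightarrow> x 0 + of_real 0" unfolding w_def by (intro tendsto_intros)
  then have "(\<lambda>j. Fin (w j)) \<longlonglongrightarrow> Fin (x 0)"
    using isCont_tendsto_compose[OF isCont_Fin] by simp
  note wlim = this
  obtain N where N: "\<And>j. \<not> dist ((F ^^ N j) (Fin (w j))) (Fin (x (N j))) < \<epsilon>"
    using escape[OF w0] by metis
  have rg: "range (\<lambda>j. F ^^ N j) \<subseteq> range (\<lambda>n. F ^^ n)" by auto
  have cn: "isCont (F ^^ N j) (Fin (x 0))" for j by (rule contn)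
  obtain r :: "nat \<Rightarrow> nat" and k \<eta> where r: "strict_mono r" "\<eta> > 0"
    and eq: "\<forall>j\<ge>k. \<forall>y\<in>K. dist y (Fin (x 0)) < \<eta> \<longrightarrow>
       dist ((F ^^ N (r j)) y) ((F ^^ N (r j)) (Fin (x 0))) < \<epsilon>"
    using normal_family_equicontinuous_subsequence[OF U(3) rg K cn \<epsilon>(1)] by blast
  have "\<forall>\<^sub>F j in sequentially. dist (Fin (w (r j))) (Fin (x 0)) < \<eta>"
    using LIMSEQ_subseq_LIMSEQ[OF wlim r(1)] r(2) unfolding tendsto_iff comp_def by blast
  then obtain j0 where "\<And>j. j \<ge> j0 \<Longrightarrow> dist (Fin (w (r j))) (Fin (x 0)) < \<eta>"
    unfolding eventually_sequentially by blast
  then have "dist ((F ^^ N (r (max k j0))) (Fin (w (r (max k j0))))) (Fin (x (N (r (max k j0))))) < \<epsilon>"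
    using eq[rule_format, of "max k j0", OF _ wK] by (simp add: orb)
  then show False using N by blast
qed

lemma isCont_at_Fin:
  fixes F :: "P1 \<Rightarrow> P1"
  assumes "isCont (\<lambda>w. F (Fin w)) z" shows "isCont F (Fin z)"
  unfolding continuous_at_eps_delta
proof (intro allI impI)
  fix e :: real assume "e > 0"
  then obtain \<delta> where \<delta>: "\<delta> > 0" "\<And>w. dist w z < \<delta> \<Longrightarrow> dist (F (Fin w)) (F (Fin z)) < e"
    using assms unfolding continuous_at_eps_delta by blast
  obtain \<epsilon> where \<epsilon>: "\<epsilon> > 0" "\<And>y. dist y (Fin z) < \<epsilon> \<Longrightarrow> \<exists>w. y = Fin w \<and> dist w z < \<delta>"
    using near_Fin_is_Fin[OF \<delta>(1), of z] by metis
  show "\<exists>d>0. \<forall>y. dist y (Fin z) < d \<longrightarrow> dist (F y) (F (Fin z)) < e"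
    using \<delta>(2) \<epsilon> by blast
qed

lemma isCont_rat_map_Fin:
  assumes "poly q z \<noteq> 0" shows "isCont (rat_map d p q) (Fin z)"
proof (rule isCont_at_Fin)
  have "isCont (\<lambda>w. Fin (poly p w / poly q w)) z"
    by (rule isCont_o2[OF _ isCont_Fin]) (use assms in \<open>intro continuous_intros\<close>)
  moreover have "\<forall>\<^sub>F w in nhds z. poly q w \<noteq> 0"
  proof (rule tendsto_imp_eventually_ne[OF _ assms])
    show "(poly q \<longlongrightarrow> poly q z) (nhds z)"
      using tendsto_at_iff_tendsto_nhds[of "poly q" z] poly_isCont[of z q] by (simp add: isCont_def)
  qed
  then have "\<forall>\<^sub>F w in nhds z. rat_map d p q (Fin w) = Fin (poly p w / poly q w)"
    by eventually_elim (simp add: proj_def)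
  ultimately show "isCont (\<lambda>w. rat_map d p q (Fin w)) z"
    by (simp add: isCont_cong)
qed

section \<open>Preperiodic orbits in a family\<close>

text \<open>Orbits in homogeneous coordinates. They depend holomorphically on the parameter even when the
  orbit passes through infinity.\<close>

primrec hom_orbit :: "nat \<Rightarrow> complex poly \<Rightarrow> complex poly \<Rightarrow> complex \<Rightarrow> nat \<Rightarrow> complex \<times> complex" where
  "hom_orbit d p q z 0 = (z, 1)"
| "hom_orbit d p q z (Suc n) =
     (hom_eval d p (fst (hom_orbit d p q z n)) (snd (hom_orbit d p q z n)),
      hom_eval d q (fst (hom_orbit d p q z n)) (snd (hom_orbit d p q z n)))"

lemma hom_orbit_iterate:
  assumes "rat_pair d p q"
  shows "(fst (hom_orbit d p q z n) \<noteq> 0 \<or> snd (hom_orbit d p q z n) \<noteq> 0) \<and>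
    (rat_map d p q ^^ n) (Fin z) = proj (fst (hom_orbit d p q z n)) (snd (hom_orbit d p q z n))"
proof (induction n)
  case 0
  show ?case by (simp add: Fin_eq_proj)
next
  case (Suc n)
  then show ?case using rat_pair_nonzero[OF assms, of "fst (hom_orbit d p q z n)" "snd (hom_orbit d p q z n)"]
    by (auto simp: case_prod_unfold rat_map_proj rat_pair_degrees[OF assms])
qed

lemma hom_orbit_holomorphic:
  assumes "\<And>i. i \<le> d \<Longrightarrow> (\<lambda>t. coeff (p t) i) holomorphic_on U"
    "\<And>i. i \<le> d \<Longrightarrow> (\<lambda>t. coeff (q t) i) holomorphic_on U" "u holomorphic_on U"
  shows "(\<lambda>t. fst (hom_orbit d (p t) (q t) (u t) n)) holomorphic_on U"
    and "(\<lambda>t. snd (hom_orbit d (p t) (q t) (u t) n)) holomorphic_on U"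
proof -
  have "(\<lambda>t. fst (hom_orbit d (p t) (q t) (u t) n)) holomorphic_on U \<and>
    (\<lambda>t. snd (hom_orbit d (p t) (q t) (u t) n)) holomorphic_on U"
  proof (induction n)
    case 0
    show ?case using assms(3) by simp
  next
    case (Suc n)
    have "(\<lambda>t. hom_eval d (r t) (fst (hom_orbit d (p t) (q t) (u t) n)) (snd (hom_orbit d (p t) (q t) (u t) n))) holomorphic_on U"
      if "\<And>i. i \<le> d \<Longrightarrow> (\<lambda>t. coeff (r t) i) holomorphic_on U" for r
      unfolding hom_eval_def using that Suc by (intro holomorphic_intros) auto
    then show ?case using assms(1,2) by (simp add: case_prod_unfold)
  qed
  then show "(\<lambda>t. fst (hom_orbit d (p t) (q t) (u t) n)) holomorphic_on U"
    "(\<lambda>t. snd (hom_orbit d (p t) (q t) (u t) n)) holomorphic_on U" by auto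
qed

text \<open>For each pair \<open>(m, n)\<close> the parameters with \<open>G\<^sup>m u = G\<^sup>n u\<close> are the zeros of a holomorphic
  function. Countably many such sets cover the disk, which is uncountable, so one of the functions
  has uncountably many zeros and vanishes identically.\<close>

lemma uniform_preperiod:
  assumes r: "r > 0" and rp: "\<And>t. t \<in> ball z0 r \<Longrightarrow> rat_pair d (p t) (q t)"
    and hol: "\<And>i. i \<le> d \<Longrightarrow> (\<lambda>t. coeff (p t) i) holomorphic_on ball z0 r"
      "\<And>i. i \<le> d \<Longrightarrow> (\<lambda>t. coeff (q t) i) holomorphic_on ball z0 r" "u holomorphic_on ball z0 r"
    and pre: "\<And>t. t \<in> ball z0 r \<Longrightarrow> Fin (u t) \<in> Preper (rat_map d (p t) (q t))"
  obtains m n where "m < n"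
    "\<And>t. t \<in> ball z0 r \<Longrightarrow> (rat_map d (p t) (q t) ^^ m) (Fin (u t)) = (rat_map d (p t) (q t) ^^ n) (Fin (u t))"
proof -
  let ?X = "\<lambda>n t. fst (hom_orbit d (p t) (q t) (u t) n)" and ?Y = "\<lambda>n t. snd (hom_orbit d (p t) (q t) (u t) n)"
  define W where "W mn t = ?X (fst mn) t * ?Y (snd mn) t - ?X (snd mn) t * ?Y (fst mn) t" for mn t
  have eq: "(rat_map d (p t) (q t) ^^ m) (Fin (u t)) = (rat_map d (p t) (q t) ^^ n) (Fin (u t)) \<longleftrightarrow> W (m, n) t = 0"
    if "t \<in> ball z0 r" for m n t
    using hom_orbit_iterate[OF rp[OF that], of "u t" m] hom_orbit_iterate[OF rp[OF that], of "u t" n]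
    by (auto simp: W_def proj_eq_iff)
  have "ball z0 r \<subseteq> (\<Union>mn\<in>{(m, n). m < n}. {t \<in> ball z0 r. W mn t = 0})"
    using pre eq unfolding Preper_def by fastforce
  moreover have "uncountable (ball z0 r)" using r by (rule uncountable_ball)
  moreover have "countable {(m, n :: nat). (m :: nat) < n}" by (rule countableI_type)
  ultimately obtain mn where mn: "mn \<in> {(m, n). m < n}" "uncountable {t \<in> ball z0 r. W mn t = 0}"
    by (meson countable_UN countable_subset)
  have "fsigma (ball z0 r)"
    using open_Union_compact_subsets[OF open_ball, of z0 r] fsigma_Union_compact[of "ball z0 r"]
    by (metis (no_types, lifting) image_subset_iff mem_Collect_eq)
  moreover have "W mn holomorphic_on ball z0 r"
    unfolding W_def by (intro holomorphic_intros hom_orbit_holomorphic hol)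
  ultimately have "W mn constant_on ball z0 r"
    using holomorphic_countable_zeros[of "W mn" "ball z0 r"] mn(2) by auto
  moreover obtain t1 where "t1 \<in> ball z0 r" "W mn t1 = 0"
    using mn(2) by (metis (mono_tags, lifting) Collect_empty_eq countable_empty)
  ultimately have "W mn t = 0" if "t \<in> ball z0 r" for t
    using that unfolding constant_on_def by metis
  then show ?thesis using that[of "fst mn" "snd mn"] mn(1) eq by auto
qed

lemma orbit_near_finite_orbit:
  assumes rp: "\<forall>\<^sub>F t in nhds 0. rat_pair d (p t) (q t)"
    and cont: "\<And>i. i \<le> d \<Longrightarrow> isCont (\<lambda>t. coeff (p t) i) 0" "\<And>i. i \<le> d \<Longrightarrow> isCont (\<lambda>t. coeff (q t) i) 0"
      "isCont u (0 :: complex)"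
    and fin: "(rat_map d (p 0) (q 0) ^^ n) (Fin (u 0)) = Fin b" and \<delta>: "\<delta> > 0"
  shows "\<forall>\<^sub>F t in nhds 0. \<exists>w\<in>cball b \<delta>. (rat_map d (p t) (q t) ^^ n) (Fin (u t)) = Fin w"
proof -
  let ?X = "\<lambda>n t. fst (hom_orbit d (p t) (q t) (u t) n)" and ?Y = "\<lambda>n t. snd (hom_orbit d (p t) (q t) (u t) n)"
  have XY: "isCont (?X n) 0 \<and> isCont (?Y n) 0"
  proof (induction n)
    case 0
    show ?case using cont(3) by simp
  next
    case (Suc n)
    have "isCont (\<lambda>t. hom_eval d (r t) (?X n t) (?Y n t)) 0"
      if "\<And>i. i \<le> d \<Longrightarrow> isCont (\<lambda>t. coeff (r t) i) 0" for r
      unfolding hom_eval_def using that Suc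
      by (intro continuous_sum continuous_mult continuous_power) auto
    then show ?case using cont(1,2) by (simp add: case_prod_unfold)
  qed
  have Y0: "?Y n 0 \<noteq> 0" and b: "?X n 0 / ?Y n 0 = b"
    using hom_orbit_iterate[OF eventually_nhds_x_imp_x[OF rp], of "u 0" n] fin
    by (auto simp: proj_def split: if_splits)
  have "isCont (\<lambda>t. ?X n t / ?Y n t) 0" using XY Y0 by (intro continuous_divide) auto
  then have "((\<lambda>t. ?X n t / ?Y n t) \<longlongrightarrow> b) (nhds 0)"
    using tendsto_at_iff_tendsto_nhds[of "\<lambda>t. ?X n t / ?Y n t" 0] b by (simp add: isCont_def)
  then have e1: "\<forall>\<^sub>F t in nhds 0. dist (?X n t / ?Y n t) b < \<delta>" using \<delta> by (rule tendstoD)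
  have "(?Y n \<longlongrightarrow> ?Y n 0) (nhds 0)"
    using tendsto_at_iff_tendsto_nhds[of "?Y n" 0] XY by (simp add: isCont_def)
  then have e2: "\<forall>\<^sub>F t in nhds 0. ?Y n t \<noteq> 0" using Y0 by (rule tendsto_imp_eventually_ne)
  show ?thesis using rp e1 e2
  proof eventually_elim
    case (elim t)
    then show ?case using hom_orbit_iterate[OF elim(1), of "u t" n]
      by (intro bexI[of _ "?X n t / ?Y n t"]) (auto simp: proj_def dist_commute)
  qed
qed

text \<open>Two preperiodic points have common preperiods \<open>N\<close> and common periods, which allows their orbits
  to be compared.\<close>

lemma funpow_preperiod_mult:
  fixes G :: "'a \<Rightarrow> 'a"
  assumes "(G ^^ m) x = (G ^^ n) x" "m \<le> n" "m \<le> N"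
  shows "(G ^^ (N + k * (n - m))) x = (G ^^ N) x"
proof -
  have step: "(G ^^ (M + (n - m))) x = (G ^^ M) x" if "m \<le> M" for M
  proof -
    have "M + (n - m) = (M - m) + n" "M = (M - m) + m" using that assms(2) by auto
    then have "(G ^^ (M + (n - m))) x = (G ^^ (M - m)) ((G ^^ n) x)"
      "(G ^^ M) x = (G ^^ (M - m)) ((G ^^ m) x)"
      by (metis funpow_add comp_apply)+
    then show ?thesis using assms(1) by simp
  qed
  show ?thesis
  proof (induction k)
    case (Suc k)
    have eq: "N + Suc k * (n - m) = (N + k * (n - m)) + (n - m)" by simp
    show ?case unfolding eq using step[of "N + k * (n - m)"] Suc assms(3) by simp
  qed simp
qed

text \<open>Along two orbits in the same sets \<open>B i\<close> the distance grows. From time \<open>N\<close> to time \<open>N + L\<close> it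
  returns to its value, so it is zero at time \<open>N\<close>, and then also at time \<open>0\<close>.\<close>

lemma expanding_preperiodic_unique:
  fixes G :: "P1 \<Rightarrow> P1"
  assumes u: "\<And>i. i \<le> N + L \<Longrightarrow> \<exists>w\<in>B i. (G ^^ i) x = Fin w"
    and v: "\<And>i. i \<le> N + L \<Longrightarrow> \<exists>w\<in>B i. (G ^^ i) y = Fin w"
    and ex: "\<And>i w w'. w \<in> B i \<Longrightarrow> w' \<in> B i \<Longrightarrow>
      \<exists>z z'. G (Fin w) = Fin z \<and> G (Fin w') = Fin z' \<and> norm (z - z') \<ge> 7 / 4 * norm (w - w')"
    and per: "(G ^^ (N + L)) x = (G ^^ N) x" "(G ^^ (N + L)) y = (G ^^ N) y" and L: "L > 0"
  shows "x = y"
proof -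
  obtain U where U: "\<And>i. i \<le> N + L \<Longrightarrow> U i \<in> B i" "\<And>i. i \<le> N + L \<Longrightarrow> (G ^^ i) x = Fin (U i)"
    using u by metis
  obtain V where V: "\<And>i. i \<le> N + L \<Longrightarrow> V i \<in> B i" "\<And>i. i \<le> N + L \<Longrightarrow> (G ^^ i) y = Fin (V i)"
    using v by metis
  have step: "norm (U (Suc i) - V (Suc i)) \<ge> 7 / 4 * norm (U i - V i)" if "Suc i \<le> N + L" for i
  proof -
    have "G (Fin (U i)) = Fin (U (Suc i))" "G (Fin (V i)) = Fin (V (Suc i))"
      using U(2)[of i] U(2)[of "Suc i"] V(2)[of i] V(2)[of "Suc i"] that by auto
    then show ?thesis using ex[OF U(1)[of i] V(1)[of i]] that by auto
  qed
  have grow: "norm (U (i + j) - V (i + j)) \<ge> (7 / 4) ^ j * norm (U i - V i)" if "i + j \<le> N + L" for i j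
    using that
  proof (induction j)
    case (Suc j)
    then show ?case using step[of "i + j"] by simp
  qed simp
  have eq: "U (N + L) = U N" "V (N + L) = V N" using per U(2) V(2) by simp_all
  have "(7 / 4) ^ L * norm (U N - V N) \<le> 1 * norm (U N - V N)"
    using grow[of N L] eq by simp
  moreover have "(7 / 4 :: real) ^ L > 1" using L by (simp add: one_less_power)
  ultimately have "norm (U N - V N) = 0"
    by (metis mult_le_cancel_right_pos not_le zero_less_norm_iff norm_eq_zero)
  then have "(7 / 4) ^ N * norm (U 0 - V 0) \<le> 0" using grow[of 0 N] by simp
  moreover have "(7 / 4 :: real) ^ N > 0" by simp
  ultimately have "norm (U 0 - V 0) \<le> 0" by (simp only: mult_le_0_iff) simp
  then show ?thesis using U(2)[of 0] V(2)[of 0] by simp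
qed

section \<open>The orbit portrait persists near the power maps\<close>

lemma finite_common_radius:
  assumes "finite X" "\<And>a. a \<in> X \<Longrightarrow> \<exists>e>0::real. R a e"
    and mono: "\<And>a e e'. R a e \<Longrightarrow> e' \<le> e \<Longrightarrow> R a e'"
  obtains e where "e > 0" "\<And>a. a \<in> X \<Longrightarrow> R a e"
proof -
  obtain E where E: "\<And>a. a \<in> X \<Longrightarrow> E a > 0 \<and> R a (E a)" using assms(2) by metis
  have "Min (insert 1 (E ` X)) > 0" using assms(1) E by auto
  moreover have "Min (insert 1 (E ` X)) \<le> E a" if "a \<in> X" for a using assms(1) that by simp
  ultimately show ?thesis using that mono E by meson
qed

text \<open>The inclusion of the preperiodic points of \<open>f t\<close> in its Julia set into those of \<open>g t\<close> transports
  the portrait from \<open>f\<close> to \<open>g\<close>. Both \<open>g t (x a t)\<close> and \<open>x (\<zeta> * a ^ d) t\<close> are preperiodic under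
  \<open>g t\<close> and follow the orbit of \<open>\<zeta> * a ^ d\<close> under \<open>g 0\<close> for as long as needed when \<open>t\<close> is small, so
  they coincide. The number of steps depends on \<open>a\<close>, but there are only finitely many \<open>a \<in> X\<close>.\<close>

lemma local_orbit_portrait:
  fixes p q P Q :: "complex \<Rightarrow> complex poly" and X :: "complex set"
  assumes d: "d \<ge> 2" and r0: "r0 > 0"
    and cf: "rat_chart d f (ball 0 r0) p q" and cg: "rat_chart d g (ball 0 r0) P Q"
    and p0: "p 0 = monom k d" "q 0 = [:k:]" "k \<noteq> 0"
    and P0: "P 0 = monom (\<zeta> * K) d" "Q 0 = [:K:]" "K \<noteq> 0" and \<zeta>: "norm \<zeta> = 1"
    and X: "finite X" "\<And>a. a \<in> X \<Longrightarrow> norm a = 1" "\<And>a. a \<in> X \<Longrightarrow> a ^ d \<in> X" "\<And>a. a \<in> X \<Longrightarrow> \<zeta> * a ^ d \<in> X"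
    and pre: "\<And>t. t \<in> ball 0 r0 \<Longrightarrow> Preper (f t) \<inter> Julia (f t) \<subseteq> Preper (g t)"
  shows "\<exists>x. \<forall>\<^sub>F t in nhds 0. inj_on (\<lambda>a. x a t) X \<and>
    (\<forall>a\<in>X. f t (Fin (x a t)) = Fin (x (a ^ d) t) \<and> g t (Fin (x a t)) = Fin (x (\<zeta> * a ^ d) t))"
proof -
  note rp = rat_chartD(1)[OF cf] and rP = rat_chartD(1)[OF cg]
    and hol = rat_chartD(3,4)[OF cf] rat_chartD(3,4)[OF cg]
  have in0: "0 \<in> ball (0 :: complex) r0" using r0 by simp
  have ev0: "\<forall>\<^sub>F t in nhds (0 :: complex). t \<in> ball 0 r0" using r0 by (intro eventually_nhds_in_open) auto
  have deg: "degree (p t) \<le> d" "degree (q t) \<le> d" "degree (P t) \<le> d" "degree (Q t) \<le> d"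
    if "t \<in> ball 0 r0" for t using rat_pair_degrees rp[OF that] rP[OF that] by auto
  have isC: "isCont h 0" if "h holomorphic_on ball 0 r0" for h :: "complex \<Rightarrow> complex"
    using holomorphic_on_imp_continuous_on[OF that] in0 by (simp add: continuous_on_eq_continuous_at)
  have cp: "isCont (\<lambda>t. coeff (p t) i) 0" and cq: "isCont (\<lambda>t. coeff (q t) i) 0"
    and cP: "isCont (\<lambda>t. coeff (P t) i) 0" and cQ: "isCont (\<lambda>t. coeff (Q t) i) 0" for i
    by (rule isC[OF coeffs_holomorphic[OF deg(1) hol(1)]] isC[OF coeffs_holomorphic[OF deg(2) hol(2)]]
        isC[OF coeffs_holomorphic[OF deg(3) hol(3)]] isC[OF coeffs_holomorphic[OF deg(4) hol(4)]]; assumption)+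
  have degf: "\<forall>\<^sub>F t in nhds 0. degree (p t) \<le> d \<and> degree (q t) \<le> d"
    and degg: "\<forall>\<^sub>F t in nhds 0. degree (P t) \<le> d \<and> degree (Q t) \<le> d"
    using ev0 deg by (auto elim: eventually_mono)
  define \<phi> \<gamma> where "\<phi> t z = poly (p t) z / poly (q t) z" and "\<gamma> t z = poly (P t) z / poly (Q t) z" for t z
  define c c' where "c a = of_nat d * 1 * a ^ (d - 1)" and "c' a = of_nat d * \<zeta> * a ^ (d - 1)" for a :: complex
  have nc: "norm (c a) \<ge> 2" "norm (c' a) \<ge> 2" if "a \<in> X" for a
    using X(2)[OF that] \<zeta> d by (simp_all add: c_def c'_def norm_mult norm_power)
  \<comment> \<open>The linearisations of \<open>f\<close> and \<open>g\<close> at \<open>a\<close>; as \<open>X\<close> is finite, one radius \<open>e\<close> serves all its points.\<close>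
  define R where "R a e \<longleftrightarrow> (\<forall>t\<in>ball 0 e. \<forall>u\<in>cball a e. poly (q t) u \<noteq> 0 \<and>
      (\<forall>v\<in>cball a e. norm (\<phi> t u - \<phi> t v - c a * (u - v)) \<le> 1 / 4 * norm (u - v)))" for a and e :: real
  define R' where "R' a e \<longleftrightarrow> (\<forall>t\<in>ball 0 e. \<forall>u\<in>cball a e. poly (Q t) u \<noteq> 0 \<and>
      (\<forall>v\<in>cball a e. norm (\<gamma> t u - \<gamma> t v - c' a * (u - v)) \<le> 1 / 4 * norm (u - v)))" for a and e :: real
  have mono: "R a e \<Longrightarrow> e' \<le> e \<Longrightarrow> R a e'" "R' a e \<Longrightarrow> e' \<le> e \<Longrightarrow> R' a e'" for a e e'
    unfolding R_def R'_def by (meson subset_ball subset_cball subsetD)+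
  have "\<exists>e>0. R a e" for a
    unfolding R_def \<phi>_def c_def
    by (rule near_power_map_linearised[OF degf cp cq]) (use p0 in auto)
  then obtain e1 where e1: "e1 > 0" "\<And>a. a \<in> X \<Longrightarrow> R a e1"
    using finite_common_radius[OF X(1), of R] mono(1) by metis
  have "\<exists>e>0. R' a e" for a
    unfolding R'_def \<gamma>_def c'_def
    by (rule near_power_map_linearised[OF degg cP cQ]) (use P0 in auto)
  then obtain e2 where e2: "e2 > 0" "\<And>a. a \<in> X \<Longrightarrow> R' a e2"
    using finite_common_radius[OF X(1), of R'] mono(2) by metis
  define e where "e = min e1 e2"
  have e: "e > 0" using e1 e2 by (simp add: e_def)
  have Re: "R a e" and Re': "R' a e" if "a \<in> X" for a
    using mono(1)[OF e1(2)[OF that], of e] mono(2)[OF e2(2)[OF that], of e] by (simp_all add: e_def)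
  have \<phi>0: "\<phi> 0 a = a ^ d" for a using p0 by (simp add: \<phi>_def poly_monom)
  have "\<forall>\<^sub>F t in nhds 0. \<forall>a\<in>X. dist (\<phi> t a) (a ^ d) < e / 4"
  proof (intro eventually_ball_finite[OF X(1)] ballI)
    fix a
    have "(\<lambda>t. poly (p t) a) holomorphic_on ball 0 r0" "(\<lambda>t. poly (q t) a) holomorphic_on ball 0 r0"
      by (rule holomorphic_poly_family[OF deg(1) hol(1) holomorphic_on_const]
          holomorphic_poly_family[OF deg(2) hol(2) holomorphic_on_const]; assumption)+
    then have "isCont (\<lambda>t. \<phi> t a) 0"
      unfolding \<phi>_def using p0 by (intro continuous_divide isC) auto
    from isCont_imp_tendsto_nhds[OF this] have "((\<lambda>t. \<phi> t a) \<longlongrightarrow> a ^ d) (nhds 0)" by (simp add: \<phi>0)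
    then show "\<forall>\<^sub>F t in nhds 0. dist (\<phi> t a) (a ^ d) < e / 4" by (rule tendstoD) (use e in simp)
  qed
  then obtain r1 where r1: "r1 > 0" "\<And>t a. dist t 0 < r1 \<Longrightarrow> a \<in> X \<Longrightarrow> dist (\<phi> t a) (a ^ d) < e / 4"
    unfolding eventually_nhds_metric by blast
  define r where "r = min (min r0 r1) e"
  have r: "r > 0" using r0 r1 e by (simp add: r_def)
  have U: "t \<in> ball 0 r0" "t \<in> ball 0 e" "dist t 0 < r1" if "t \<in> ball 0 r" for t
    using that by (auto simp: r_def dist_commute)
  have Ur0: "ball 0 r \<subseteq> ball (0 :: complex) r0" by (auto simp: r_def)
  obtain x where xh: "\<And>a. a \<in> X \<Longrightarrow> x a holomorphic_on ball 0 r" and x0: "\<And>a. a \<in> X \<Longrightarrow> x a 0 = a"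
    and xin: "\<And>a t. a \<in> X \<Longrightarrow> t \<in> ball 0 r \<Longrightarrow> x a t \<in> cball a (e / 2)"
    and xs: "\<And>a t. a \<in> X \<Longrightarrow> t \<in> ball 0 r \<Longrightarrow> \<phi> t (x a t) = x (a ^ d) t"
  proof (rule holomorphic_shadowing[of "ball 0 r" 0 e X "\<lambda>a. a ^ d" c \<phi>])
    show "norm (\<phi> t u - \<phi> t v - c a * (u - v)) \<le> 1 / 4 * norm (u - v)"
      if "t \<in> ball 0 r" "a \<in> X" "u \<in> cball a e" "v \<in> cball a e" for t a u v
      using Re[OF that(2)] U(2)[OF that(1)] that(3,4) unfolding R_def by blast
    show "norm (\<phi> t a - a ^ d) \<le> e / 4" if "t \<in> ball 0 r" "a \<in> X" for t a
      using r1(2)[OF U(3)[OF that(1)] that(2)] by (simp add: dist_norm)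
    show "(\<lambda>t. \<phi> t (h t)) holomorphic_on ball 0 r"
      if "a \<in> X" "h holomorphic_on ball 0 r" "h ` ball 0 r \<subseteq> cball a e" for a h
      unfolding \<phi>_def
    proof (rule holomorphic_on_divide)
      show "(\<lambda>t. poly (p t) (h t)) holomorphic_on ball 0 r" "(\<lambda>t. poly (q t) (h t)) holomorphic_on ball 0 r"
        by (rule holomorphic_poly_family[OF deg(1)[OF U(1)] holomorphic_on_subset[OF hol(1) Ur0] that(2)]
            holomorphic_poly_family[OF deg(2)[OF U(1)] holomorphic_on_subset[OF hol(2) Ur0] that(2)]; assumption)+
      show "poly (q t) (h t) \<noteq> 0" if "t \<in> ball 0 r" for t
        using Re[OF \<open>a \<in> X\<close>] U(2)[OF that] \<open>h ` ball 0 r \<subseteq> cball a e\<close> that unfolding R_def by blast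
    qed
  qed (use r e nc X(3) \<phi>0 in auto)
  let ?f = "\<lambda>t. rat_map d (p t) (q t)" and ?g = "\<lambda>t. rat_map d (P t) (Q t)"
  \<comment> \<open>The points \<open>x a t\<close> stay within \<open>e / 2\<close> of \<open>a\<close>, which leaves room for balls of radius \<open>e / 2\<close>
    around them inside the region of linearisation.\<close>
  have half: "w \<in> cball a e" if "w \<in> cball z (e / 2)" "z \<in> cball a (e / 2)" for w z a :: complex
    using that dist_triangle[of a w z] by simp
  have xine: "x a t \<in> cball a e" if "a \<in> X" "t \<in> ball 0 r" for a t
    using xin[OF that] e by auto
  have fF: "?f t (Fin w) = Fin (\<phi> t w)" and qnz: "poly (q t) w \<noteq> 0"
    if "t \<in> ball 0 r" "a \<in> X" "w \<in> cball a e" for t a w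
  proof -
    show "poly (q t) w \<noteq> 0" using Re[OF that(2)] U(2)[OF that(1)] that(3) unfolding R_def by blast
    then show "?f t (Fin w) = Fin (\<phi> t w)" by (simp add: proj_def \<phi>_def)
  qed
  have gF: "?g t (Fin w) = Fin (\<gamma> t w)" if "t \<in> ball 0 r" "a \<in> X" "w \<in> cball a e" for t a w
  proof -
    have "poly (Q t) w \<noteq> 0" using Re'[OF that(2)] U(2)[OF that(1)] that(3) unfolding R'_def by blast
    then show "?g t (Fin w) = Fin (\<gamma> t w)" by (simp add: proj_def \<gamma>_def)
  qed
  have fx: "?f t (Fin (x a t)) = Fin (x (a ^ d) t)" if "a \<in> X" "t \<in> ball 0 r" for a t
    using fF[OF that(2,1) xine[OF that]] xs[OF that] by simp
  have gpre: "Fin (x a t) \<in> Preper (?g t)" if a: "a \<in> X" and t: "t \<in> ball 0 r" for a t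
  proof -
    define s where "s n = a ^ (d ^ n)" for n
    have s: "s n \<in> X" "s (Suc n) = s n ^ d" for n
    proof -
      show sS: "s (Suc n) = s n ^ d" for n by (simp add: s_def power_mult[symmetric] mult.commute)
      show "s n \<in> X" by (induction n) (simp_all add: sS X(3), simp add: s_def a)
    qed
    have orb: "(?f t ^^ n) (Fin (x a t)) = Fin (x (s n) t)" for n
    proof (induction n)
      case (Suc n)
      then show ?case using fx[OF s(1) t, of n] by (simp only: funpow.simps comp_apply s(2))
    qed (simp add: s_def)
    have "\<not> inj s"
      using finite_subset[OF _ X(1), of "range s"] s(1) range_inj_infinite by blast
    then obtain i j where "i \<noteq> j" "s i = s j" unfolding inj_def by blast
    then have "\<exists>m n. m < n \<and> (?f t ^^ m) (Fin (x a t)) = (?f t ^^ n) (Fin (x a t))"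
      unfolding orb by (metis linorder_neqE_nat)
    then have "Fin (x a t) \<in> Preper (?f t)" unfolding Preper_def by blast
    moreover have "Fin (x (s 0) t) \<in> Julia (?f t)"
    proof (rule expanding_orbit_in_Julia[where x = "\<lambda>n. x (s n) t" and \<delta> = "e / 2"])
      show "?f t (Fin (x (s n) t)) = Fin (x (s (Suc n)) t)" for n using fx[OF s(1) t] s(2) by simp
      have "range (\<lambda>n. x (s n) t) \<subseteq> (\<lambda>b. x b t) ` X" using s(1) by auto
      then show "finite (range (\<lambda>n. x (s n) t))" using X(1) finite_subset by blast
      show "isCont (?f t) (Fin (x (s n) t))" for n
        by (rule isCont_rat_map_Fin[OF qnz[OF t s(1) xine[OF s(1) t]]])
      show "e / 2 > 0" using e by simp
      fix n w assume "w \<in> cball (x (s n) t) (e / 2)"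
      from half[OF this xin[OF s(1) t]] have w: "w \<in> cball (s n) e" .
      have "norm (\<phi> t w - \<phi> t (x (s n) t)) \<ge> 7 / 4 * norm (w - x (s n) t)"
        using Re[OF s(1)[of n]] U(2)[OF t] w xine[OF s(1) t] nc(1)[OF s(1)[of n]] unfolding R_def
        by (intro expansion_of_linearised[where c = "c (s n)"]) auto
      then show "\<exists>w'. ?f t (Fin w) = Fin w' \<and> norm (w' - x (s (Suc n)) t) \<ge> 7 / 4 * norm (w - x (s n) t)"
        using fF[OF t s(1) w] xs[OF s(1) t] s(2) by auto
    qed
    then have "Fin (x a t) \<in> Julia (?f t)" by (simp add: s_def)
    ultimately show ?thesis
      using pre[OF U(1)[OF t]] unfolding rat_chartD(2)[OF cf U(1)[OF t]] rat_chartD(2)[OF cg U(1)[OF t]] by blast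
  qed
  have "\<exists>m n. m < n \<and> (\<forall>t\<in>ball 0 r. (?g t ^^ m) (Fin (x a t)) = (?g t ^^ n) (Fin (x a t)))" if "a \<in> X" for a
    using uniform_preperiod[OF r rP[OF U(1)] holomorphic_on_subset[OF hol(3) Ur0]
        holomorphic_on_subset[OF hol(4) Ur0] xh[OF that] gpre[OF that]] by metis
  then obtain M N where MN: "\<And>a. a \<in> X \<Longrightarrow> M a < N a"
    "\<And>a t. a \<in> X \<Longrightarrow> t \<in> ball 0 r \<Longrightarrow> (?g t ^^ M a) (Fin (x a t)) = (?g t ^^ N a) (Fin (x a t))"
    by metis
  have xC: "isCont (x a) 0" if "a \<in> X" for a
    using holomorphic_on_imp_continuous_on[OF xh[OF that]] r by (simp add: continuous_on_eq_continuous_at)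
  have evr: "\<forall>\<^sub>F t in nhds (0 :: complex). t \<in> ball 0 r" using r by (intro eventually_nhds_in_open) auto
  have evP: "\<forall>\<^sub>F t in nhds 0. rat_pair d (P t) (Q t)" using ev0 by eventually_elim (rule rP)
  have gx: "\<forall>\<^sub>F t in nhds 0. ?g t (Fin (x a t)) = Fin (x (\<zeta> * a ^ d) t)" if a: "a \<in> X" for a
  proof -
    define b where "b = \<zeta> * a ^ d"
    have b: "b \<in> X" unfolding b_def by (rule X(4)[OF a])
    define s where "s i = ((\<lambda>z. \<zeta> * z ^ d) ^^ i) a" for i
    have s: "s i \<in> X" "s (Suc i) = \<zeta> * s i ^ d" for i
      by (induction i) (simp_all add: s_def a X(4))
    have s1: "s (Suc i) = ((\<lambda>z. \<zeta> * z ^ d) ^^ i) b" for i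
      by (induction i) (simp_all add: s_def b_def)
    have g0: "?g 0 (Fin z) = Fin (\<zeta> * z ^ d)" for z using P0 by (simp add: proj_def poly_monom)
    have orb: "(?g 0 ^^ i) (Fin z) = Fin (((\<lambda>z. \<zeta> * z ^ d) ^^ i) z)" for i z
      by (induction i) (simp_all add: g0 del: rat_map.simps)
    \<comment> \<open>a preperiod and a period shared by \<open>g t (x a t)\<close> and \<open>x b t\<close>\<close>
    let ?N = "M a + M b" and ?L = "(N a - M a) * (N b - M b)"
    have "\<forall>\<^sub>F t in nhds 0. \<forall>i\<in>{..?N + ?L}. \<exists>w\<in>cball (s (Suc i)) e. (?g t ^^ Suc i) (Fin (x a t)) = Fin w"
      by (intro eventually_ball_finite ballI orbit_near_finite_orbit evP cP cQ xC[OF a] e finite_atMost)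
        (simp only: orb x0[OF a] s_def)
    moreover have "\<forall>\<^sub>F t in nhds 0. \<forall>i\<in>{..?N + ?L}. \<exists>w\<in>cball (s (Suc i)) e. (?g t ^^ i) (Fin (x b t)) = Fin w"
      by (intro eventually_ball_finite ballI orbit_near_finite_orbit evP cP cQ xC[OF b] e finite_atMost)
        (simp only: orb x0[OF b] s1)
    ultimately show ?thesis using evr
    proof eventually_elim
      case (elim t)
      have per: "(?g t ^^ (?N + ?L)) (Fin (x a t)) = (?g t ^^ ?N) (Fin (x a t))"
        using funpow_preperiod_mult[OF MN(2)[OF a elim(3)], of ?N "N b - M b"] MN(1)[OF a] by (simp add: mult.commute)
      have "?g t (Fin (x a t)) = Fin (x b t)"
      proof (rule expanding_preperiodic_unique[where N = ?N and L = ?L and B = "\<lambda>i. cball (s (Suc i)) e" and G = "?g t"])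
        show "\<exists>w\<in>cball (s (Suc i)) e. (?g t ^^ i) (?g t (Fin (x a t))) = Fin w" if "i \<le> ?N + ?L" for i
          using elim(1) that by (simp add: funpow_swap1)
        show "\<exists>w\<in>cball (s (Suc i)) e. (?g t ^^ i) (Fin (x b t)) = Fin w" if "i \<le> ?N + ?L" for i
          using elim(2) that by simp
        show "\<exists>z z'. ?g t (Fin w) = Fin z \<and> ?g t (Fin w') = Fin z' \<and> norm (z - z') \<ge> 7 / 4 * norm (w - w')"
          if "w \<in> cball (s (Suc i)) e" "w' \<in> cball (s (Suc i)) e" for i w w'
        proof (intro exI conjI)
          show "?g t (Fin w) = Fin (\<gamma> t w)" "?g t (Fin w') = Fin (\<gamma> t w')"
            using gF[OF elim(3) s(1)[of "Suc i"]] that by blast+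
          show "norm (\<gamma> t w - \<gamma> t w') \<ge> 7 / 4 * norm (w - w')"
            using Re'[OF s(1)[of "Suc i"]] U(2)[OF elim(3)] that nc(2)[OF s(1)[of "Suc i"]] unfolding R'_def
            by (intro expansion_of_linearised[where c = "c' (s (Suc i))"]) auto
        qed
        show "(?g t ^^ (?N + ?L)) (?g t (Fin (x a t))) = (?g t ^^ ?N) (?g t (Fin (x a t)))"
          using arg_cong[OF per, of "?g t"] by (simp only: funpow_swap1)
        show "(?g t ^^ (?N + ?L)) (Fin (x b t)) = (?g t ^^ ?N) (Fin (x b t))"
          using funpow_preperiod_mult[OF MN(2)[OF b elim(3)], of ?N "N a - M a"] MN(1)[OF b] by simp
        show "?L > 0" using MN(1) a b by simp
      qed
      then show ?case unfolding b_def .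
    qed
  qed
  have "\<forall>\<^sub>F t in nhds 0. \<forall>ab\<in>X \<times> X. fst ab \<noteq> snd ab \<longrightarrow> x (fst ab) t \<noteq> x (snd ab) t"
  proof (intro eventually_ball_finite ballI finite_cartesian_product X(1))
    fix ab assume ab: "ab \<in> X \<times> X"
    show "\<forall>\<^sub>F t in nhds 0. fst ab \<noteq> snd ab \<longrightarrow> x (fst ab) t \<noteq> x (snd ab) t"
    proof (cases "fst ab = snd ab")
      case False
      have "isCont (\<lambda>t. x (fst ab) t - x (snd ab) t) 0"
        using ab by (intro continuous_intros xC) auto
      moreover have "x (fst ab) 0 - x (snd ab) 0 \<noteq> 0" using False ab by (auto simp: x0)
      ultimately have "\<forall>\<^sub>F t in nhds 0. x (fst ab) t - x (snd ab) t \<noteq> 0"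
        using isCont_imp_tendsto_nhds tendsto_imp_eventually_ne by blast
      then show ?thesis by eventually_elim auto
    qed simp
  qed
  moreover have "\<forall>\<^sub>F t in nhds 0. \<forall>a\<in>X. ?g t (Fin (x a t)) = Fin (x (\<zeta> * a ^ d) t)"
    by (intro eventually_ball_finite X(1) ballI gx)
  ultimately have "\<forall>\<^sub>F t in nhds 0. inj_on (\<lambda>a. x a t) X \<and>
    (\<forall>a\<in>X. f t (Fin (x a t)) = Fin (x (a ^ d) t) \<and> g t (Fin (x a t)) = Fin (x (\<zeta> * a ^ d) t))"
    using evr
  proof eventually_elim
    case (elim t)
    then show ?case
      unfolding rat_chartD(2)[OF cf U(1)[OF elim(3)]] rat_chartD(2)[OF cg U(1)[OF elim(3)]]
      by (auto simp: inj_on_def fx simp del: rat_map.simps)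
  qed
  then show ?thesis by blast
qed

section \<open>From the centre to the whole disk\<close>

lemma cfdet_holomorphic:
  assumes "\<And>k. (\<lambda>t. coeff (p t) k) holomorphic_on U" "\<And>k. (\<lambda>t. coeff (q t) k) holomorphic_on U"
  shows "(\<lambda>t. cfdet i j (p t) (q t)) holomorphic_on U"
  unfolding cfdet_def by (intro holomorphic_intros assms)

lemma isCont_cfdet:
  assumes "\<And>k. isCont (\<lambda>t. coeff (p t) k) a" "\<And>k. isCont (\<lambda>t. coeff (q t) k) a"
  shows "isCont (\<lambda>t. cfdet i j (p t) (q t)) a"
  unfolding cfdet_def by (intro continuous_intros assms)

text \<open>The portrait gives an eigenvalue ratio \<open>\<rho>\<close> with \<open>\<rho> ^ (d + 1) = 1\<close>, so \<open>T = trace\<^sup>2 / det\<close> takes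
  values in the finite set of the \<open>(1 + \<rho>)\<^sup>2 / \<rho>\<close>. It is continuous with value
  \<open>(1 + \<zeta>)\<^sup>2 / \<zeta>\<close> at the centre, hence constant near it.\<close>

lemma twisted_near_power_maps:
  fixes p q P Q :: "complex \<Rightarrow> complex poly"
  assumes d: "d \<ge> 2" and r0: "r0 > 0"
    and cf: "rat_chart d f (ball 0 r0) p q" and cg: "rat_chart d g (ball 0 r0) P Q"
    and p0: "p 0 = monom k d" "q 0 = [:k:]" "k \<noteq> 0"
    and P0: "P 0 = monom (\<zeta> * K) d" "Q 0 = [:K:]" "K \<noteq> 0"
    and \<zeta>: "\<zeta> ^ (d + 1) = 1" "\<zeta> \<noteq> 1"
    and pre: "\<And>t. t \<in> ball 0 r0 \<Longrightarrow> Preper (f t) \<inter> Julia (f t) \<subseteq> Preper (g t)"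
  shows "\<forall>\<^sub>F t in nhds 0. twisted_pair \<zeta> (f t) (g t)"
proof -
  note rp = rat_chartD(1)[OF cf] and rP = rat_chartD(1)[OF cg]
    and hol = rat_chartD(3,4)[OF cf] rat_chartD(3,4)[OF cg]
  define X where "X = {z :: complex. z ^ (2 * d * (d + 1)) = 1}"
  have N: "2 * d * (d + 1) > 0" using d by simp
  have "finite X" unfolding X_def by (rule finite_nth_roots[OF N])
  have n\<zeta>: "norm \<zeta> = 1"
  proof -
    have "norm \<zeta> ^ (d + 1) = 1" using \<zeta>(1) by (metis norm_one norm_power)
    then show ?thesis by (intro power_eq_imp_eq_base[of "norm \<zeta>" "d + 1" 1]) auto
  qed
  then have z0: "\<zeta> \<noteq> 0" by (intro notI) simp
  have nX: "norm a = 1" if "a \<in> X" for a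
  proof -
    have "norm a ^ (2 * d * (d + 1)) = norm (a ^ (2 * d * (d + 1)))" by (rule norm_power[symmetric])
    also have "\<dots> = 1" using that unfolding X_def by simp
    finally have "norm a ^ (2 * d * (d + 1)) = 1 ^ (2 * d * (d + 1))" by (simp only: power_one)
    then show ?thesis by (rule power_eq_imp_eq_base[OF _ norm_ge_zero zero_le_one N])
  qed
  have Xd: "a ^ d \<in> X" "\<zeta> * a ^ d \<in> X" if "a \<in> X" for a
  proof -
    have "(a ^ d) ^ (2 * d * (d + 1)) = (a ^ (2 * d * (d + 1))) ^ d" by (simp only: power_mult[symmetric] mult.commute)
    then have 1: "(a ^ d) ^ (2 * d * (d + 1)) = 1" using that by (simp add: X_def)
    then show "a ^ d \<in> X" by (simp add: X_def)
    have "\<zeta> ^ (2 * d * (d + 1)) = (\<zeta> ^ (d + 1)) ^ (2 * d)" by (simp only: power_mult[symmetric] mult.commute)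
    then show "\<zeta> * a ^ d \<in> X" using 1 \<zeta>(1) unfolding X_def mem_Collect_eq power_mult_distrib by simp
  qed
  obtain x where port: "\<forall>\<^sub>F t in nhds 0. inj_on (\<lambda>a. x a t) X \<and>
    (\<forall>a\<in>X. f t (Fin (x a t)) = Fin (x (a ^ d) t) \<and> g t (Fin (x a t)) = Fin (x (\<zeta> * a ^ d) t))"
    using local_orbit_portrait[OF d r0 cf cg p0 P0 n\<zeta> \<open>finite X\<close> nX Xd pre] by blast
  have ev0: "\<forall>\<^sub>F t in nhds (0 :: complex). t \<in> ball 0 r0" using r0 by (intro eventually_nhds_in_open) auto
  have in0: "0 \<in> ball (0 :: complex) r0" using r0 by simp
  have isC: "isCont h 0" if "h holomorphic_on ball 0 r0" for h :: "complex \<Rightarrow> complex"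
    using holomorphic_on_imp_continuous_on[OF that] in0 by (simp add: continuous_on_eq_continuous_at)
  note degs = rat_pair_degrees[OF rp] rat_pair_degrees[OF rP]
  note cp = isC[OF coeffs_holomorphic[OF degs(1) hol(1)]] and cq = isC[OF coeffs_holomorphic[OF degs(2) hol(2)]]
    and cP = isC[OF coeffs_holomorphic[OF degs(3) hol(3)]] and cQ = isC[OF coeffs_holomorphic[OF degs(4) hol(4)]]
  define \<Delta> A B C E where "\<Delta> t = cfdet d 0 (p t) (q t)" and "A t = cfdet d 0 (P t) (q t)"
    and "B t = cfdet d 0 (p t) (P t)" and "C t = cfdet d 0 (Q t) (q t)" and "E t = cfdet d 0 (p t) (Q t)" for t
  have cont: "isCont \<Delta> 0" "isCont A 0" "isCont B 0" "isCont C 0" "isCont E 0"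
    unfolding \<Delta>_def[abs_def] A_def[abs_def] B_def[abs_def] C_def[abs_def] E_def[abs_def]
    by (intro isCont_cfdet cp cq cP cQ; assumption)+
  have at0: "\<Delta> 0 = k * k" "A 0 = \<zeta> * K * k" "B 0 = 0" "C 0 = 0" "E 0 = k * K"
    using d by (simp_all add: \<Delta>_def A_def B_def C_def E_def cfdet_def p0 P0 coeff_pCons split: nat.splits)
  define T where "T t = (A t + E t)\<^sup>2 / (A t * E t - B t * C t)" for t
  define \<kappa> where "\<kappa> \<rho> = (1 + \<rho>)\<^sup>2 / \<rho>" for \<rho> :: complex
  have det0: "A 0 * E 0 - B 0 * C 0 \<noteq> 0" unfolding at0 using p0 P0 z0 by simp
  have T0: "T 0 = \<kappa> \<zeta>"
  proof -
    have "T 0 = ((1 + \<zeta>)\<^sup>2 * (k * K)\<^sup>2) / (\<zeta> * (k * K)\<^sup>2)"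
      unfolding T_def at0 by (simp add: power2_eq_square algebra_simps)
    then show ?thesis using p0 P0 by (simp add: \<kappa>_def)
  qed
  have "isCont T 0" unfolding T_def[abs_def] using det0 by (intro continuous_intros cont)
  then have limT: "(T \<longlongrightarrow> \<kappa> \<zeta>) (nhds 0)" using isCont_imp_tendsto_nhds T0 by metis
  define R where "R = \<kappa> ` {\<rho>. \<rho> ^ (d + 1) = 1} - {\<kappa> \<zeta>}"
  have "finite R" unfolding R_def by (intro finite_Diff finite_imageI finite_nth_roots) simp
  then have "open (- R)" by (simp add: finite_imp_closed open_Compl)
  then have evT: "\<forall>\<^sub>F t in nhds 0. T t \<in> - R"
    using topological_tendstoD[OF limT, of "- R"] by (simp add: R_def)
  have ev\<Delta>: "\<forall>\<^sub>F t in nhds 0. \<Delta> t \<noteq> 0"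
    by (rule tendsto_imp_eventually_ne[OF isCont_imp_tendsto_nhds[OF cont(1)]]) (simp add: at0 p0)
  have "isCont (\<lambda>t. A t * E t - B t * C t) 0" by (intro continuous_intros cont)
  from tendsto_imp_eventually_ne[OF isCont_imp_tendsto_nhds[OF this] det0]
  have evdet: "\<forall>\<^sub>F t in nhds 0. A t * E t - B t * C t \<noteq> 0" .
  show ?thesis using port ev0 evT ev\<Delta> evdet
  proof eventually_elim
    case (elim t)
    obtain a b c e \<rho> where m: "P t = smult a (p t) + smult b (q t)" "Q t = smult c (p t) + smult e (q t)"
      and \<rho>: "\<rho> ^ (d + 1) = 1" "\<rho> * (a + e)\<^sup>2 = (1 + \<rho>)\<^sup>2 * (a * e - b * c)"
      and sq: "square_defect d (p t) (q t) (P t) (Q t) = 0"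
      by (rule twisted_of_portrait[OF d rp[OF elim(2)] rP[OF elim(2)] \<zeta>, of "\<lambda>a. x a t"])
        (use elim(1) rat_chartD(2)[OF cf elim(2)] rat_chartD(2)[OF cg elim(2)] in
          \<open>auto simp: X_def simp del: rat_map.simps\<close>)
    have \<rho>0: "\<rho> \<noteq> 0" using \<rho>(1) by (auto simp: power_0_left)
    have ABCE: "A t = a * \<Delta> t" "B t = b * \<Delta> t" "C t = c * \<Delta> t" "E t = e * \<Delta> t"
      unfolding A_def B_def C_def E_def \<Delta>_def m by (rule cfdet_linear)+
    have "A t * E t - B t * C t = (a * e - b * c) * (\<Delta> t)\<^sup>2" "(A t + E t)\<^sup>2 = (a + e)\<^sup>2 * (\<Delta> t)\<^sup>2"
      unfolding ABCE by (simp_all add: power2_eq_square algebra_simps)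
    then have det: "a * e - b * c \<noteq> 0" and T: "T t = (a + e)\<^sup>2 / (a * e - b * c)"
      using elim(4,5) by (auto simp: T_def)
    have "T t = \<kappa> \<rho>" unfolding T \<kappa>_def using \<rho>(2) \<rho>0 det by (simp add: frac_eq_eq mult.commute)
    then have "T t = \<kappa> \<zeta>" using elim(3) \<rho>(1) by (auto simp: R_def)
    then have "\<zeta> * (a + e)\<^sup>2 = (1 + \<zeta>)\<^sup>2 * (a * e - b * c)"
      unfolding T \<kappa>_def using z0 det by (simp add: frac_eq_eq mult.commute)
    then have "twist_equations \<zeta> d d 0 (p t) (q t) (P t) (Q t)"
      by (rule twist_equations_if_matrix[OF m]) (simp add: sq)
    then show ?case
      unfolding rat_chartD(2)[OF cf elim(2)] rat_chartD(2)[OF cg elim(2)]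
      using twist_equations_iff[OF rp[OF elim(2)] rP[OF elim(2)], of d 0] d elim(4) by (simp add: \<Delta>_def)
  qed
qed

text \<open>Each of the equations that characterise twistedness is an identity between holomorphic functions
  of the parameter.\<close>

lemma twisted_pair_continuation:
  assumes d: "d \<ge> 1" and B: "open B" "connected B" and B': "open B'" "B' \<noteq> {}" "B' \<subseteq> B"
    and cf: "rat_chart d f B p q" and cg: "rat_chart d g B P Q"
    and nz: "\<And>t. t \<in> B \<Longrightarrow> cfdet i j (p t) (q t) \<noteq> 0"
    and tw: "\<And>t. t \<in> B' \<Longrightarrow> twisted_pair \<zeta> (f t) (g t)" and t: "t \<in> B"
  shows "twisted_pair \<zeta> (f t) (g t)"
proof -
  note rp = rat_chartD(1)[OF cf] and rP = rat_chartD(1)[OF cg]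
    and hol = rat_chartD(3,4)[OF cf] rat_chartD(3,4)[OF cg]
  have eqB': "twist_equations \<zeta> d i j (p s) (q s) (P s) (Q s)" if "s \<in> B'" for s
  proof -
    have s: "s \<in> B" using that B'(3) by blast
    show ?thesis
      using tw[OF that] twist_equations_iff[OF rp[OF s] rP[OF s] d nz[OF s]]
      unfolding rat_chartD(2)[OF cf s] rat_chartD(2)[OF cg s] by blast
  qed
  have ident: "F t = G t" if "F holomorphic_on B" "G holomorphic_on B" "\<And>s. s \<in> B' \<Longrightarrow> F s = G s"
    for F G :: "complex \<Rightarrow> complex"
    by (rule analytic_continuation_open[OF B'(1) B(1) B'(2) B(2) B'(3) that t])
  note degs = rat_pair_degrees[OF rp] rat_pair_degrees[OF rP]
  note cp = coeffs_holomorphic[OF degs(1) hol(1)] and cq = coeffs_holomorphic[OF degs(2) hol(2)]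
    and cP = coeffs_holomorphic[OF degs(3) hol(3)] and cQ = coeffs_holomorphic[OF degs(4) hol(4)]
  have hc: "(\<lambda>t. cfdet i j (p t) (q t)) holomorphic_on B" "(\<lambda>t. cfdet i j (P t) (q t)) holomorphic_on B"
    "(\<lambda>t. cfdet i j (p t) (P t)) holomorphic_on B" "(\<lambda>t. cfdet i j (Q t) (q t)) holomorphic_on B"
    "(\<lambda>t. cfdet i j (p t) (Q t)) holomorphic_on B"
    by (intro cfdet_holomorphic cp cq cP cQ; assumption)+
  have hp: "(\<lambda>t. poly (p t) z) holomorphic_on B" "(\<lambda>t. poly (q t) z) holomorphic_on B"
    "(\<lambda>t. poly (P t) z) holomorphic_on B" "(\<lambda>t. poly (Q t) z) holomorphic_on B" for z
    by (rule holomorphic_poly_family[OF degs(1) hol(1) holomorphic_on_const]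
      holomorphic_poly_family[OF degs(2) hol(2) holomorphic_on_const]
      holomorphic_poly_family[OF degs(3) hol(3) holomorphic_on_const]
      holomorphic_poly_family[OF degs(4) hol(4) holomorphic_on_const]; assumption)+
  have hh: "(\<lambda>t. hom_eval d (r t) (u t) (v t)) holomorphic_on B"
    if "\<And>i. i \<le> d \<Longrightarrow> (\<lambda>t. coeff (r t) i) holomorphic_on B" "u holomorphic_on B" "v holomorphic_on B"
    for r u v unfolding hom_eval_def using that by (intro holomorphic_intros) auto
  have hs: "(\<lambda>t. poly (square_defect d (p t) (q t) (P t) (Q t)) z) holomorphic_on B" for z
    unfolding square_defect_def poly_diff poly_mult poly_hom_comp
    by (intro holomorphic_intros hh hol hp)
  have "twist_equations \<zeta> d i j (p t) (q t) (P t) (Q t)"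
    unfolding twist_equations_def
  proof (intro conjI allI impI)
    fix k assume k: "k \<le> d"
    show "cfdet i j (p t) (q t) * coeff (P t) k = cfdet i j (P t) (q t) * coeff (p t) k + cfdet i j (p t) (P t) * coeff (q t) k"
      by (rule ident[where F = "\<lambda>t. cfdet i j (p t) (q t) * coeff (P t) k"])
        (use eqB' k in \<open>auto simp: twist_equations_def intro!: holomorphic_intros hc hol\<close>)
    show "cfdet i j (p t) (q t) * coeff (Q t) k = cfdet i j (Q t) (q t) * coeff (p t) k + cfdet i j (p t) (Q t) * coeff (q t) k"
      by (rule ident[where F = "\<lambda>t. cfdet i j (p t) (q t) * coeff (Q t) k"])
        (use eqB' k in \<open>auto simp: twist_equations_def intro!: holomorphic_intros hc hol\<close>)
  next
    show "\<zeta> * (cfdet i j (P t) (q t) + cfdet i j (p t) (Q t))\<^sup>2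
       = (1 + \<zeta>)\<^sup>2 * (cfdet i j (P t) (q t) * cfdet i j (p t) (Q t) - cfdet i j (p t) (P t) * cfdet i j (Q t) (q t))"
      by (rule ident[where F = "\<lambda>t. \<zeta> * (cfdet i j (P t) (q t) + cfdet i j (p t) (Q t))\<^sup>2"])
        (use eqB' in \<open>auto simp: twist_equations_def intro!: holomorphic_intros hc\<close>)
  next
    fix z show "poly (square_defect d (p t) (q t) (P t) (Q t)) z = 0"
      by (rule ident[where F = "\<lambda>t. poly (square_defect d (p t) (q t) (P t) (Q t)) z"])
        (use eqB' hs in \<open>auto simp: twist_equations_def\<close>)
  qed
  then show ?thesis
    unfolding rat_chartD(2)[OF cf t] rat_chartD(2)[OF cg t]
    using twist_equations_iff[OF rp[OF t] rP[OF t] d nz[OF t]] by blast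
qed

lemma rat_pair_monom: "c \<noteq> 0 \<Longrightarrow> rat_pair d (monom c d) 1"
  by (simp add: rat_pair_def degree_monom_eq)

lemma common_rat_charts:
  assumes f: "holomorphic_to_Rat d f S" and g: "holomorphic_to_Rat d g S" and t0: "t0 \<in> S"
  shows "\<exists>r>0. ball t0 r \<subseteq> S \<and>
    (\<exists>p q P Q. rat_chart d f (ball t0 r) p q \<and> rat_chart d g (ball t0 r) P Q)"
proof -
  obtain U p q where U: "open U" "t0 \<in> U" "U \<subseteq> S" "rat_chart d f U p q"
    using f t0 unfolding holomorphic_to_Rat_def rat_chart_def by metis
  obtain V P Q where V: "open V" "t0 \<in> V" "rat_chart d g V P Q"
    using g t0 unfolding holomorphic_to_Rat_def rat_chart_def by metis
  obtain r where r: "r > 0" "ball t0 r \<subseteq> U \<inter> V"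
    using open_contains_ball[of "U \<inter> V"] U(1,2) V(1,2) by blast
  then have sub: "ball t0 r \<subseteq> U" "ball t0 r \<subseteq> V" by auto
  with r U(3) rat_chart_subset[OF U(4)] rat_chart_subset[OF V(3)] show ?thesis by blast
qed

theorem theorem1p9:
  fixes d :: nat and f g :: "complex \<Rightarrow> P1 \<Rightarrow> P1"
  assumes "d \<ge> 2"
    and "holomorphic_to_Rat d f (ball 0 1)"
    and "holomorphic_to_Rat d g (ball 0 1)"
    and "f 0 = rat_map d (monom 1 d) 1"
    and "g 0 = rat_map d (monom (exp (2 * of_real pi * \<i> / of_nat (d + 1))) d) 1"
    and "\<And>t. t \<in> ball 0 1 \<Longrightarrow> Preper (f t) \<inter> Julia (f t) = Preper (g t) \<inter> Julia (g t)"
  shows "isotrivial_on (ball 0 1) (\<lambda>t. (f t, g t))"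
proof -
  define \<zeta> where "\<zeta> = exp (2 * of_real pi * \<i> / of_nat (d + 1))"
  have \<zeta>pow: "\<zeta> ^ i = exp (2 * of_real pi * \<i> * of_nat i / of_nat (d + 1))" for i
    unfolding \<zeta>_def exp_of_nat_mult[symmetric] by (simp add: mult_ac)
  have \<zeta>: "\<zeta> ^ i = \<zeta> ^ j \<longleftrightarrow> i mod (d + 1) = j mod (d + 1)" for i j
    unfolding \<zeta>pow by (rule complex_root_unity_eq) simp
  have \<zeta>1: "\<zeta> ^ (d + 1) = 1" "\<zeta> \<noteq> 1" using \<zeta>[of "d + 1" 0] \<zeta>[of 1 0] assms(1) by auto
  have \<zeta>0: "\<zeta> \<noteq> 0" by (simp add: \<zeta>_def)
  define Tw where "Tw t \<longleftrightarrow> twisted_pair \<zeta> (f t) (g t)" for t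
  let ?D = "ball (0 :: complex) 1"
  define S where "S = {t. \<forall>\<^sub>F s in nhds t. Tw s}"
  have "open S"
    unfolding S_def open_subopen[of "{t. \<forall>\<^sub>F s in nhds t. Tw s}"]
    by (auto simp: eventually_nhds)
  have S0: "0 \<in> S"
  proof -
    have "0 \<in> ?D" by simp
    from common_rat_charts[OF assms(2,3) this] obtain r p q P Q where r: "r > 0" "ball 0 r \<subseteq> ?D"
      and cf: "rat_chart d f (ball 0 r) p q" and cg: "rat_chart d g (ball 0 r) P Q" by blast
    note rp = rat_chartD(1)[OF cf] rat_chartD(1)[OF cg] and fg = rat_chartD(2)[OF cf] rat_chartD(2)[OF cg]
    have in0: "0 \<in> ball (0 :: complex) r" using r by simp
    have "infinite {z. rat_map d (monom 1 d) 1 (Fin z) = rat_map d (p 0) (q 0) (Fin z)}"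
      unfolding fg(1)[OF in0, symmetric] assms(4) by (simp add: infinite_UNIV_char_0)
    from rat_map_unique[OF rat_pair_monom rp(1)[OF in0] this]
    obtain k where k: "k \<noteq> 0" "p 0 = smult k (monom 1 d)" "q 0 = smult k 1" by auto
    have "infinite {z. rat_map d (monom \<zeta> d) 1 (Fin z) = rat_map d (P 0) (Q 0) (Fin z)}"
      unfolding fg(2)[OF in0, symmetric] assms(5) \<zeta>_def by (simp add: infinite_UNIV_char_0)
    from rat_map_unique[OF rat_pair_monom[OF \<zeta>0] rp(2)[OF in0] this]
    obtain K where K: "K \<noteq> 0" "P 0 = smult K (monom \<zeta> d)" "Q 0 = smult K 1" by auto
    have "\<forall>\<^sub>F t in nhds 0. twisted_pair \<zeta> (f t) (g t)"
    proof (rule twisted_near_power_maps[OF assms(1) r(1) cf cg])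
      show "p 0 = monom k d" "q 0 = [:k:]" "P 0 = monom (\<zeta> * K) d" "Q 0 = [:K:]"
        using k K by (simp_all add: smult_monom mult.commute smult_one)
      show "Preper (f t) \<inter> Julia (f t) \<subseteq> Preper (g t)" if "t \<in> ball 0 r" for t
        using assms(6)[OF subsetD[OF r(2) that]] by blast
    qed (use k K \<zeta>1 in auto)
    then show ?thesis by (simp add: S_def Tw_def)
  qed
  have nbhd: "\<exists>B. open B \<and> t0 \<in> B \<and> (B \<inter> S \<noteq> {} \<longrightarrow> (\<forall>t\<in>B. Tw t))" if "t0 \<in> ?D" for t0
  proof -
    from common_rat_charts[OF assms(2,3) that] obtain r p q P Q where r: "r > 0" "ball t0 r \<subseteq> ?D"
      and cf: "rat_chart d f (ball t0 r) p q" and cg: "rat_chart d g (ball t0 r) P Q" by blast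
    note rp = rat_chartD(1)[OF cf] and h = rat_chartD(3,4)[OF cf]
    have int0: "t0 \<in> ball t0 r" using r by simp
    have d1: "d \<ge> 1" using assms(1) by simp
    obtain i j where ij: "cfdet i j (p t0) (q t0) \<noteq> 0"
      using cfdet_nonzero[OF rp[OF int0] d1] by blast
    have "(\<lambda>t. cfdet i j (p t) (q t)) holomorphic_on ball t0 r"
      by (intro cfdet_holomorphic coeffs_holomorphic[OF rat_pair_degrees(1)[OF rp] h(1)]
          coeffs_holomorphic[OF rat_pair_degrees(2)[OF rp] h(2)]; assumption)
    from holomorphic_on_imp_continuous_on[OF this] have "isCont (\<lambda>t. cfdet i j (p t) (q t)) t0"
      using int0 by (simp add: continuous_on_eq_continuous_at)
    from tendsto_imp_eventually_ne[OF isCont_imp_tendsto_nhds[OF this] ij]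
    obtain e where e: "e > 0" "\<And>t. dist t t0 < e \<Longrightarrow> cfdet i j (p t) (q t) \<noteq> 0"
      unfolding eventually_nhds_metric by blast
    define B where "B = ball t0 (min r e)"
    have B: "open B" "t0 \<in> B" "connected B" "B \<subseteq> ball t0 r" using r e by (auto simp: B_def)
    have "\<forall>t\<in>B. Tw t" if ne: "B \<inter> S \<noteq> {}"
    proof
      fix t assume t: "t \<in> B"
      have twS: "Tw s" if "s \<in> S" for s using that eventually_nhds_x_imp_x by (auto simp: S_def)
      show "Tw t" unfolding Tw_def
      proof (rule twisted_pair_continuation[OF d1 B(1,3) _ ne _
            rat_chart_subset[OF cf B(4)] rat_chart_subset[OF cg B(4)] _ _ t])
        show "open (B \<inter> S)" using B(1) \<open>open S\<close> by (rule open_Int)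
        show "twisted_pair \<zeta> (f s) (g s)" if "s \<in> B \<inter> S" for s
          using twS[of s] that by (simp add: Tw_def)
        show "cfdet i j (p s) (q s) \<noteq> 0" if "s \<in> B" for s
          using e(2)[of s] that by (simp add: B_def dist_commute)
      qed simp
    qed
    then show ?thesis using B by blast
  qed
  \<comment> \<open>\<open>V\<close> is the exterior of \<open>S\<close>; the two open sets cover the disk, which is connected.\<close>
  define V where "V = \<Union>{B. open B \<and> B \<inter> S = {}}"
  have "open V" unfolding V_def by (rule open_Union) auto
  have VS: "V \<inter> S = {}" unfolding V_def by auto
  have "?D \<subseteq> S \<union> V"
  proof
    fix t0 assume "t0 \<in> ?D"
    from nbhd[OF this] obtain B where B: "open B" "t0 \<in> B" "B \<inter> S \<noteq> {} \<longrightarrow> (\<forall>t\<in>B. Tw t)" by blast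
    show "t0 \<in> S \<union> V"
    proof (cases "B \<inter> S = {}")
      case True
      then show ?thesis using B unfolding V_def by blast
    next
      case False
      then show ?thesis using B unfolding S_def eventually_nhds by blast
    qed
  qed
  moreover have "S \<inter> V \<inter> ?D = {}" using VS by blast
  ultimately have "S \<inter> ?D = {} \<or> V \<inter> ?D = {}"
    using connectedD[OF connected_ball \<open>open S\<close> \<open>open V\<close>] by blast
  moreover have "0 \<in> S \<inter> ?D" using S0 by simp
  ultimately have "V \<inter> ?D = {}" by blast
  with \<open>?D \<subseteq> S \<union> V\<close> have "?D \<subseteq> S" by blast
  then have Tw: "Tw t" if "t \<in> ?D" for t
    using that eventually_nhds_x_imp_x unfolding S_def by blast
  have "conj_orbit (f t, g t) = conj_orbit (rat_map d (monom 1 d) 1, rat_map d (monom \<zeta> d) 1)" if t: "t \<in> ?D" for t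
  proof -
    obtain p q where "rat_pair d p q" "f t = rat_map d p q"
      using assms(2) t unfolding holomorphic_to_Rat_def by metis
    then obtain A where "A \<in> Aut_P1" "f t = A \<circ> rat_map d (monom 1 d) 1 \<circ> inv A"
      "g t = A \<circ> rat_map d (monom \<zeta> d) 1 \<circ> inv A"
      using twisted_pair_conj_power[OF _ _ assms(1) Tw[OF t, unfolded Tw_def] \<zeta>] by blast
    then show ?thesis using conj_orbit_conj by simp
  qed
  then show ?thesis unfolding isotrivial_on_def constant_on_def by blast
qed

end
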